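(* Let $G$ be a group equipped with a conjugation-invariant norm and let $T$ be an ample scaling set. There exists a continuous function $\hat h\colon[0,\infty)\times\hat{\mathcal{C}}(G,T)\to\hat{\mathcal{C}}(G,T)$ such that $$\hat h(t,\hat\pi(x))=\hat\pi(h(t,x))\qquad\text{for all }t\in[0,\infty),\ x\in\hat{\mathcal{D}}(G,T).$$ It has the property that the maps $\hat h_t=\hat h(t,\cdot)\colon\hat{\mathcal{C}}(G,T)\to\hat{\mathcal{C}}(G,T)$ are homomorphisms such that $\|\hat h_t(x)\|=t\cdot\|x\|$ for all $x\in\hat{\mathcal{C}}(G,T)$, $\hat h_1=\mathrm{id}$, $\hat h_0$ is the trivial homomorphism, and $\hat h_t\circ\hat h_s=\hat h_{ts}$. In particular, $\hat{\mathcal{C}}(G,T)$ is contractible and $\mathrm{End}(\hat{\mathcal{C}}(G,T))$ is contractible.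
   Context: Norms. A norm on a group $G$ is a function $\|\cdot\|\colon G\to[0,\infty)$ with $\|g\|=0\iff g=1$, $\|g^{-1}\|=\|g\|$ and $\|gh\|\le\|g\|+\|h\|$; for a pseudonorm one only requires $\|1\|=0$ instead of the first condition. It is conjugation-invariant if $\|hgh^{-1}\|=\|g\|$ for all $g,h$. It induces the bi-invariant (pseudo)metric $d(g,h)=\|g^{-1}h\|$, making the group a topological group; all metric and topological notions refer to it. The groups $F_{\mathbb{R}}(G)$ and $F(G)$. $F_{\mathbb{R}}(G)$ is the free product of copies of the additive group $\mathbb{R}$ indexed by the elements $g$ of the set $G$; the element $r$ of the copy indexed by $g$ is written $\overline{g}(r)$. It carries the conjugation-invariant pseudonorm $$\|x\|=\inf\Big\{\sum_{i=1}^n |r_i|\,\|g_i\| : x=\prod_{i=1}^n h_i\,\overline{g_i}(r_i)^{\pm1}h_i^{-1},\ h_i\in F_{\mathbb{R}}(G)\Big\}.$$ $F(G)\le F_{\mathbb{R}}(G)$ is the subgroup generated by the elements $\overline{g}:=\overline{g}(1)$; it is free on $\{\overline{g}: g\in G\}$. For $t\in\mathbb{R}$, $\psi_t\colon F_{\mathbb{R}}(G)\to F_{\mathbb{R}}(G)$ is the homomorphism with $\psi_t(\overline{g}(r))=\overline{g}(tr)$. $\pi\colon F(G)\to G$ is the homomorphism with $\pi(\overline{g})=g$. Directional asymptotic cone. A scaling set is an unbounded subset $T\subseteq(0,\infty)$; limits over $t\in T$ are taken as $t\to\infty$. $T$ is ample if for every $s>0$ there is a function $\sigma\colon T\to T$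 with $\lim_{t\in T}\sigma(t)/t=s$. A function $f$ from $T$ to a pseudometric space is Cauchy if for every $\epsilon>0$, $d(f(t),f(t'))<\epsilon$ for all sufficiently large $t,t'\in T$. $\mathcal{D}(G,T)$ is the group (pointwise product) of all functions $w\colon T\to F(G)$ such that $t\mapsto\psi_{1/t}(w(t))\in F_{\mathbb{R}}(G)$ is Cauchy, with pseudonorm $\|w\|=\lim_{t\in T}\|\psi_{1/t}(w(t))\|$; $\hat{\mathcal{D}}(G,T)$ is its quotient by the normal subgroup of elements of pseudonorm $0$, with the induced norm. $\mathcal{C}(G,T)=\{\pi\circ w: w\in\mathcal{D}(G,T)\}$, a group of functions $T\to G$, with pseudonorm $\|g\|=\inf\{\|w\|: w\in\mathcal{D}(G,T),\ \pi\circ w=g\}$. The directional asymptotic cone $\hat{\mathcal{C}}(G,T)$ is the quotient of $\mathcal{C}(G,T)$ by the normal subgroup of elements of pseudonorm $0$, with the induced conjugation-invariant norm. Classes are denoted $[w]$, $[g]$, and $\hat\pi\colon\hat{\mathcal{D}}(G,T)\to\hat{\mathcal{C}}(G,T)$ is the epimorphism $[w]\mapsto[\pi\circ w]$. The map $h$. Let $\iota\colon F_{\mathbb{R}}(G)\to\hat{\mathcal{D}}(G,T)$ be the (well-defined, norm preserving, dense image) homomorphism sending $\overline{g_1}(r_1)\cdots\overline{g_k}(r_k)$ to the class of $t\mapsto\overline{g_1}^{\lfloor tr_1\rfloor}\cdots\overline{g_k}^{\lfloor tr_k\rfloor}$. Then $h\colon\mathbb{R}\times\hat{\mathcal{D}}(G,T)\to\hat{\mathcal{D}}(G,T)$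 is the unique continuous map with $h(t,\iota(x))=\iota(\psi_t(x))$ for all $t\in\mathbb{R}$, $x\in F_{\mathbb{R}}(G)$; each $h(t,\cdot)$ is a homomorphism. For a topological group $K$, $\mathrm{End}(K)$ denotes the set of continuous endomorphisms of $K$ with the compact-open topology. *)

theory Defs
  imports
    "HOL-Analysis.Analysis"
    "HOL-Algebra.Elementary_Groups"
    "HOL-Algebra.Product_Groups"
begin

section \<open>Norms on groups\<close>

definition conj_inv_norm :: "('a, 'b) monoid_scheme \<Rightarrow> ('a \<Rightarrow> real) \<Rightarrow> bool" where
  "conj_inv_norm G N \<longleftrightarrow>
     (\<forall>g\<in>carrier G. 0 \<le> N g) \<and>
     (\<forall>g\<in>carrier G. N g = 0 \<longleftrightarrow> g = \<one>\<^bsub>G\<^esub>) \<and>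
     (\<forall>g\<in>carrier G. N (inv\<^bsub>G\<^esub> g) = N g) \<and>
     (\<forall>g\<in>carrier G. \<forall>h\<in>carrier G. N (g \<otimes>\<^bsub>G\<^esub> h) \<le> N g + N h) \<and>
     (\<forall>g\<in>carrier G. \<forall>h\<in>carrier G. N (h \<otimes>\<^bsub>G\<^esub> g \<otimes>\<^bsub>G\<^esub> inv\<^bsub>G\<^esub> h) = N g)"

text \<open>The value off the carrier is irrelevant; it is set to 0 because the locale
  \<^locale>\<open>Metric_space\<close> demands nonnegativity and symmetry on the whole type.\<close>

definition group_dist :: "('a, 'b) monoid_scheme \<Rightarrow> ('a \<Rightarrow> real) \<Rightarrow> 'a \<Rightarrow> 'a \<Rightarrow> real" where
  "group_dist K N x y =
     (if x \<in> carrier K \<and> y \<in> carrier K then N (inv\<^bsub>K\<^esub> x \<otimes>\<^bsub>K\<^esub> y) else 0)"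

definition group_topology :: "('a, 'b) monoid_scheme \<Rightarrow> ('a \<Rightarrow> real) \<Rightarrow> 'a topology" where
  "group_topology K N = Metric_space.mtopology (carrier K) (group_dist K N)"

text \<open>Quotient by the elements of pseudonorm 0. A map that is constant on each coset descends
  to the quotient, its value on a coset \<open>X\<close> being the unique element of the image of \<open>X\<close>.\<close>

definition null_set :: "('a, 'b) monoid_scheme \<Rightarrow> ('a \<Rightarrow> real) \<Rightarrow> 'a set" where
  "null_set K N = {x \<in> carrier K. N x = 0}"

definition null_quotient :: "('a, 'b) monoid_scheme \<Rightarrow> ('a \<Rightarrow> real) \<Rightarrow> 'a set monoid" where
  "null_quotient K N = K Mod null_set K N"

definition null_class :: "('a, 'b) monoid_scheme \<Rightarrow> ('a \<Rightarrow> real) \<Rightarrow> 'a \<Rightarrow> 'a set" where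
  "null_class K N x = null_set K N #>\<^bsub>K\<^esub> x"

definition induced_norm :: "('a \<Rightarrow> real) \<Rightarrow> 'a set \<Rightarrow> real" where
  "induced_norm N X = the_elem (N ` X)"


section \<open>Free product of copies of the reals\<close>

text \<open>Normal forms in the free product: words of letters \<open>(g, r)\<close>, with \<open>g\<close> an index and
  \<open>r \<noteq> 0\<close> an element of the copy of the reals indexed by \<open>g\<close>, in which neighbouring letters
  have different indices. The function \<open>fr_cons\<close> multiplies a normal form by a letter on the
  left.\<close>

fun fr_cons :: "'a \<times> real \<Rightarrow> ('a \<times> real) list \<Rightarrow> ('a \<times> real) list" where
  "fr_cons (g, r) [] = (if r = 0 then [] else [(g, r)])"
| "fr_cons (g, r) ((g', s) # w) =
     (if r = 0 then (g', s) # w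
      else if g = g' then (if r + s = 0 then w else (g, r + s) # w)
      else (g, r) # (g', s) # w)"

definition FR :: "('a, 'b) monoid_scheme \<Rightarrow> ('a \<times> real) list monoid" where
  "FR G = \<lparr>carrier = {w. set w \<subseteq> carrier G \<times> (UNIV - {0}) \<and> distinct_adj (map fst w)},
          monoid.mult = (\<lambda>u v. foldr fr_cons u v),
          one = []\<rparr>"

definition fr_gen :: "'a \<Rightarrow> real \<Rightarrow> ('a \<times> real) list" where
  "fr_gen g r = (if r = 0 then [] else [(g, r)])"

text \<open>The homomorphism to \<open>H\<close> sending the element \<open>r\<close> of the copy indexed by \<open>g\<close> to
  \<open>\<phi> g r\<close>.\<close>

definition fr_eval :: "('c, 'd) monoid_scheme \<Rightarrow> ('a \<Rightarrow> real \<Rightarrow> 'c) \<Rightarrow> ('a \<times> real) list \<Rightarrow> 'c" where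
  "fr_eval H \<phi> w = foldr (\<lambda>(g, r) y. \<phi> g r \<otimes>\<^bsub>H\<^esub> y) w \<one>\<^bsub>H\<^esub>"

definition fr_norm :: "('a, 'b) monoid_scheme \<Rightarrow> ('a \<Rightarrow> real) \<Rightarrow> ('a \<times> real) list \<Rightarrow> real" where
  "fr_norm G N x = Inf {(\<Sum>(h, g, r, e)\<leftarrow>ps. \<bar>r\<bar> * N g) | ps.
     set ps \<subseteq> carrier (FR G) \<times> carrier G \<times> (UNIV :: real set) \<times> {1, -1 :: int} \<and>
     x = foldr (\<lambda>(h, g, r, e) y.
           (h \<otimes>\<^bsub>FR G\<^esub> (fr_gen g r [^]\<^bsub>FR G\<^esub> e) \<otimes>\<^bsub>FR G\<^esub> inv\<^bsub>FR G\<^esub> h) \<otimes>\<^bsub>FR G\<^esub> y) ps \<one>\<^bsub>FR G\<^esub>}"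

definition FZ :: "('a, 'b) monoid_scheme \<Rightarrow> ('a \<times> real) list monoid" where
  "FZ G = subgroup_generated (FR G) {fr_gen g 1 | g. g \<in> carrier G}"

definition fr_scale :: "('a, 'b) monoid_scheme \<Rightarrow> real \<Rightarrow> ('a \<times> real) list \<Rightarrow> ('a \<times> real) list" where
  "fr_scale G t = fr_eval (FR G) (\<lambda>g r. fr_gen g (t * r))"

text \<open>Only used on \<^term>\<open>FZ G\<close>, where all exponents are integers, so that the floor just
  converts the exponent to type \<^typ>\<open>int\<close>.\<close>

definition fz_proj :: "('a, 'b) monoid_scheme \<Rightarrow> ('a \<times> real) list \<Rightarrow> 'a" where
  "fz_proj G = fr_eval G (\<lambda>g r. g [^]\<^bsub>G\<^esub> \<lfloor>r\<rfloor>)"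


section \<open>The directional asymptotic cone\<close>

definition scaling_set :: "real set \<Rightarrow> bool" where
  "scaling_set T \<longleftrightarrow> T \<subseteq> {0<..} \<and> \<not> bounded T"

definition at_top_in :: "real set \<Rightarrow> real filter" where
  "at_top_in T = inf at_top (principal T)"

definition ample :: "real set \<Rightarrow> bool" where
  "ample T \<longleftrightarrow> (\<forall>s>0. \<exists>\<sigma>. \<sigma> \<in> T \<rightarrow> T \<and> ((\<lambda>t. \<sigma> t / t) \<longlongrightarrow> s) (at_top_in T))"

definition cauchy_in :: "('a \<Rightarrow> 'a \<Rightarrow> real) \<Rightarrow> real set \<Rightarrow> (real \<Rightarrow> 'a) \<Rightarrow> bool" where
  "cauchy_in d T f \<longleftrightarrow>
     (\<forall>\<epsilon>>0. \<exists>t0. \<forall>t\<in>T. \<forall>t'\<in>T. t0 \<le> t \<longrightarrow> t0 \<le> t' \<longrightarrow> d (f t) (f t') < \<epsilon>)"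

definition DD :: "('a, 'b) monoid_scheme \<Rightarrow> ('a \<Rightarrow> real) \<Rightarrow> real set \<Rightarrow>
    (real \<Rightarrow> ('a \<times> real) list) monoid" where
  "DD G N T = (product_group T (\<lambda>_. FZ G))
     \<lparr>carrier := {w \<in> carrier (product_group T (\<lambda>_. FZ G)).
        cauchy_in (group_dist (FR G) (fr_norm G N)) T (\<lambda>t. fr_scale G (1 / t) (w t))}\<rparr>"

definition DD_norm :: "('a, 'b) monoid_scheme \<Rightarrow> ('a \<Rightarrow> real) \<Rightarrow> real set \<Rightarrow>
    (real \<Rightarrow> ('a \<times> real) list) \<Rightarrow> real" where
  "DD_norm G N T w = Lim (at_top_in T) (\<lambda>t. fr_norm G N (fr_scale G (1 / t) (w t)))"

definition DD_hat :: "('a, 'b) monoid_scheme \<Rightarrow> ('a \<Rightarrow> real) \<Rightarrow> real set \<Rightarrow>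
    (real \<Rightarrow> ('a \<times> real) list) set monoid" where
  "DD_hat G N T = null_quotient (DD G N T) (DD_norm G N T)"

definition DD_hat_norm :: "('a, 'b) monoid_scheme \<Rightarrow> ('a \<Rightarrow> real) \<Rightarrow> real set \<Rightarrow>
    (real \<Rightarrow> ('a \<times> real) list) set \<Rightarrow> real" where
  "DD_hat_norm G N T = induced_norm (DD_norm G N T)"

text \<open>Composition with the projection \<open>fz_proj\<close>, as an extensional function on \<open>T\<close>.\<close>

definition push :: "('a, 'b) monoid_scheme \<Rightarrow> real set \<Rightarrow> (real \<Rightarrow> ('a \<times> real) list) \<Rightarrow> real \<Rightarrow> 'a" where
  "push G T w = (\<lambda>t\<in>T. fz_proj G (w t))"

definition CC :: "('a, 'b) monoid_scheme \<Rightarrow> ('a \<Rightarrow> real) \<Rightarrow> real set \<Rightarrow> (real \<Rightarrow> 'a) monoid" where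
  "CC G N T = (product_group T (\<lambda>_. G)) \<lparr>carrier := push G T ` carrier (DD G N T)\<rparr>"

definition CC_norm :: "('a, 'b) monoid_scheme \<Rightarrow> ('a \<Rightarrow> real) \<Rightarrow> real set \<Rightarrow> (real \<Rightarrow> 'a) \<Rightarrow> real" where
  "CC_norm G N T g = Inf {DD_norm G N T w | w. w \<in> carrier (DD G N T) \<and> push G T w = g}"

definition CC_hat :: "('a, 'b) monoid_scheme \<Rightarrow> ('a \<Rightarrow> real) \<Rightarrow> real set \<Rightarrow>
    (real \<Rightarrow> 'a) set monoid" where
  "CC_hat G N T = null_quotient (CC G N T) (CC_norm G N T)"

definition CC_hat_norm :: "('a, 'b) monoid_scheme \<Rightarrow> ('a \<Rightarrow> real) \<Rightarrow> real set \<Rightarrow>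
    (real \<Rightarrow> 'a) set \<Rightarrow> real" where
  "CC_hat_norm G N T = induced_norm (CC_norm G N T)"

definition proj_hat :: "('a, 'b) monoid_scheme \<Rightarrow> ('a \<Rightarrow> real) \<Rightarrow> real set \<Rightarrow>
    (real \<Rightarrow> ('a \<times> real) list) set \<Rightarrow> (real \<Rightarrow> 'a) set" where
  "proj_hat G N T X = the_elem ((\<lambda>w. null_class (CC G N T) (CC_norm G N T) (push G T w)) ` X)"


section \<open>The dilations of \<open>DD_hat\<close>\<close>

definition iota :: "('a, 'b) monoid_scheme \<Rightarrow> ('a \<Rightarrow> real) \<Rightarrow> real set \<Rightarrow> ('a \<times> real) list \<Rightarrow>
    (real \<Rightarrow> ('a \<times> real) list) set" where
  "iota G N T x = null_class (DD G N T) (DD_norm G N T)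
     (\<lambda>t\<in>T. fr_eval (FR G) (\<lambda>g r. fr_gen g 1 [^]\<^bsub>FR G\<^esub> \<lfloor>t * r\<rfloor>) x)"

text \<open>The unique continuous extension of \<open>fr_scale\<close> along \<open>iota\<close>; extensionality makes
  it unique as a HOL function.\<close>

definition dilation :: "('a, 'b) monoid_scheme \<Rightarrow> ('a \<Rightarrow> real) \<Rightarrow> real set \<Rightarrow>
    real \<times> (real \<Rightarrow> ('a \<times> real) list) set \<Rightarrow> (real \<Rightarrow> ('a \<times> real) list) set" where
  "dilation G N T = (THE h.
     h \<in> extensional (UNIV \<times> carrier (DD_hat G N T)) \<and>
     continuous_map
       (prod_topology euclideanreal (group_topology (DD_hat G N T) (DD_hat_norm G N T)))
       (group_topology (DD_hat G N T) (DD_hat_norm G N T)) h \<and>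
     (\<forall>t. \<forall>x\<in>carrier (FR G). h (t, iota G N T x) = iota G N T (fr_scale G t x)))"


section \<open>Continuous endomorphisms\<close>

definition cont_End :: "('a, 'b) monoid_scheme \<Rightarrow> 'a topology \<Rightarrow> ('a \<Rightarrow> 'a) set" where
  "cont_End K X = {f \<in> hom K K. f \<in> extensional (carrier K) \<and> continuous_map X X f}"

definition End_topology :: "('a, 'b) monoid_scheme \<Rightarrow> 'a topology \<Rightarrow> ('a \<Rightarrow> 'a) topology" where
  "End_topology K X = topology_generated_by
     {{f \<in> cont_End K X. f ` C \<subseteq> U} | C U. compactin X C \<and> openin X U}"

lemma topspace_End_topology: "topspace (End_topology K X) = cont_End K X"
  unfolding End_topology_def topology_generated_by_topspace
  by (auto intro!: exI[of _ "{}"])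


section \<open>Basic facts on the free product\<close>

lemma fr_cons_gen: "fr_cons (g, r) [] = fr_gen g r"
  by (simp add: fr_gen_def)

lemma fr_cons_zero [simp]: "fr_cons (g, 0) w = w"
  by (cases w) auto

lemma fr_cons_closed:
  assumes "w \<in> carrier (FR G)" "g \<in> carrier G"
  shows "fr_cons (g, r) w \<in> carrier (FR G)"
  using assms by (cases w) (auto simp: FR_def distinct_adj_Cons split: if_splits)

lemma fr_cons_reduced:
  assumes "(g, r) # w \<in> carrier (FR G)"
  shows "fr_cons (g, r) w = (g, r) # w" "w \<in> carrier (FR G)" "g \<in> carrier G" "r \<noteq> 0"
  using assms by (cases w; auto simp: FR_def distinct_adj_Cons)+

lemma fr_cons_add:
  assumes "w \<in> carrier (FR G)"
  shows "fr_cons (g, r) (fr_cons (g, s) w) = fr_cons (g, r + s) w"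
proof (cases w)
  case (Cons a w')
  obtain g' q where a: "a = (g', q)" by (cases a)
  show ?thesis
  proof (cases "g = g'")
    case True
    then show ?thesis using assms Cons a
      by (cases w') (auto simp: FR_def distinct_adj_Cons add_eq_0_iff algebra_simps)
  qed (use Cons a in \<open>auto simp: add_eq_0_iff\<close>)
qed (auto simp: add_eq_0_iff)

lemma fr_mult_closed:
  assumes "set u \<subseteq> carrier G \<times> UNIV" "v \<in> carrier (FR G)"
  shows "foldr fr_cons u v \<in> carrier (FR G)"
  using assms by (induction u) (auto intro: fr_cons_closed)

lemma FR_letters: "w \<in> carrier (FR G) \<Longrightarrow> set w \<subseteq> carrier G \<times> UNIV"
  by (auto simp: FR_def)

lemma fr_cons_mult:
  assumes "u \<in> carrier (FR G)" "v \<in> carrier (FR G)"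
  shows "foldr fr_cons (fr_cons (g, r) u) v = fr_cons (g, r) (foldr fr_cons u v)"
proof (cases u)
  case (Cons a u')
  obtain g' s where a: "a = (g', s)" by (cases a)
  have "foldr fr_cons u' v \<in> carrier (FR G)"
    using assms FR_letters[OF assms(1)] Cons by (intro fr_mult_closed) auto
  note add = fr_cons_add[OF this]
  show ?thesis
    by (auto simp: Cons a add)
qed auto

lemma fr_mult_one: "u \<in> carrier (FR G) \<Longrightarrow> foldr fr_cons u [] = u"
proof (induction u)
  case (Cons a u)
  then show ?case by (cases a) (metis foldr.simps(2) comp_apply fr_cons_reduced(1,2))
qed simp

lemma fr_inverse:
  assumes "u \<in> carrier (FR G)"
  shows "foldr fr_cons (map (\<lambda>(g, r). (g, - r)) (rev u)) u = []"
  using assms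
proof (induction u)
  case (Cons a u)
  obtain g r where a: "a = (g, r)" by (cases a)
  have "fr_cons (g, - r) ((g, r) # u) = u"
    using fr_cons_reduced[OF Cons.prems[unfolded a]] by auto
  then show ?case
    using Cons fr_cons_reduced(2)[OF Cons.prems[unfolded a]] by (simp add: a)
qed simp

lemma group_FR: "group (FR G)"
proof (rule groupI)
  show "x \<otimes>\<^bsub>FR G\<^esub> y \<in> carrier (FR G)" if "x \<in> carrier (FR G)" "y \<in> carrier (FR G)" for x y
    using fr_mult_closed[OF FR_letters[OF that(1)] that(2)] by (simp add: FR_def)
  show "\<one>\<^bsub>FR G\<^esub> \<in> carrier (FR G)" by (simp add: FR_def)
  show "x \<otimes>\<^bsub>FR G\<^esub> y \<otimes>\<^bsub>FR G\<^esub> z = x \<otimes>\<^bsub>FR G\<^esub> (y \<otimes>\<^bsub>FR G\<^esub> z)"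
    if x: "x \<in> carrier (FR G)" and y: "y \<in> carrier (FR G)" and z: "z \<in> carrier (FR G)" for x y z
  proof -
    have "foldr fr_cons (foldr fr_cons u y) z = foldr fr_cons u (foldr fr_cons y z)"
      if "set u \<subseteq> carrier G \<times> UNIV" for u
      using that
    proof (induction u)
      case (Cons a u)
      then show ?case
        using fr_cons_mult[OF fr_mult_closed[OF _ y] z] by (cases a) auto
    qed simp
    then show ?thesis using FR_letters[OF x] by (simp add: FR_def)
  qed
  show "\<one>\<^bsub>FR G\<^esub> \<otimes>\<^bsub>FR G\<^esub> x = x" for x by (simp add: FR_def)
  show "\<exists>y\<in>carrier (FR G). y \<otimes>\<^bsub>FR G\<^esub> x = \<one>\<^bsub>FR G\<^esub>" if x: "x \<in> carrier (FR G)" for x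
  proof (rule bexI)
    show "map (\<lambda>(g, r). (g, - r)) (rev x) \<in> carrier (FR G)"
    proof -
      have "map fst (map (\<lambda>(g, r). (g, - r)) (rev x)) = rev (map fst x)"
        by (simp add: rev_map case_prod_unfold comp_def)
      then show ?thesis using x unfolding FR_def by (force simp del: map_map)
    qed
    show "map (\<lambda>(g, r). (g, - r)) (rev x) \<otimes>\<^bsub>FR G\<^esub> x = \<one>\<^bsub>FR G\<^esub>"
      using fr_inverse[OF x] by (simp add: FR_def)
  qed
qed

lemma fr_gen_closed: "g \<in> carrier G \<Longrightarrow> fr_gen g r \<in> carrier (FR G)"
  by (simp add: FR_def fr_gen_def)

lemma fr_gen_add: "fr_gen g r \<otimes>\<^bsub>FR G\<^esub> fr_gen g s = fr_gen g (r + s)"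
  by (auto simp: FR_def fr_gen_def)

text \<open>Multiplicativity of \<open>fr_eval\<close>, for exponents in a subgroup \<open>S\<close> of the reals
  (all of them, or the integers).\<close>

lemma fr_eval_closed:
  assumes "group H" "\<And>g r. g \<in> carrier G \<Longrightarrow> \<phi> g r \<in> carrier H" "set w \<subseteq> carrier G \<times> UNIV"
  shows "fr_eval H \<phi> w \<in> carrier H"
proof -
  interpret group H by fact
  show ?thesis using assms(2,3) by (induction w) (auto simp: fr_eval_def)
qed

lemma fr_eval_mult:
  assumes H: "group H" and cl: "\<And>g r. g \<in> carrier G \<Longrightarrow> \<phi> g r \<in> carrier H"
    and add: "\<And>g r s. g \<in> carrier G \<Longrightarrow> r \<in> S \<Longrightarrow> s \<in> S \<Longrightarrow> \<phi> g (r + s) = \<phi> g r \<otimes>\<^bsub>H\<^esub> \<phi> g s"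
    and S: "0 \<in> S" "\<And>r s. r \<in> S \<Longrightarrow> s \<in> S \<Longrightarrow> r + s \<in> S"
    and u: "set u \<subseteq> carrier G \<times> S" and v: "set v \<subseteq> carrier G \<times> S"
  shows "fr_eval H \<phi> (foldr fr_cons u v) = fr_eval H \<phi> u \<otimes>\<^bsub>H\<^esub> fr_eval H \<phi> v"
    and "set (foldr fr_cons u v) \<subseteq> carrier G \<times> S"
proof -
  interpret group H by fact
  have zero: "\<phi> g 0 = \<one>\<^bsub>H\<^esub>" if "g \<in> carrier G" for g
    using add[OF that S(1) S(1)] cl[OF that, of 0] by (metis add_0 l_cancel_one)
  have ecl: "fr_eval H \<phi> w \<in> carrier H" if "set w \<subseteq> carrier G \<times> S" for w
    using that by (intro fr_eval_closed[OF H, of G] cl) auto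
  have cons: "fr_eval H \<phi> (fr_cons (g, r) w) = \<phi> g r \<otimes>\<^bsub>H\<^esub> fr_eval H \<phi> w \<and>
              set (fr_cons (g, r) w) \<subseteq> carrier G \<times> S"
    if g: "g \<in> carrier G" "r \<in> S" and w: "set w \<subseteq> carrier G \<times> S" for g r w
  proof (cases w)
    case Nil
    then show ?thesis using that zero cl by (auto simp: fr_eval_def)
  next
    case (Cons a w')
    obtain g' s where a: "a = (g', s)" by (cases a)
    have s: "g' \<in> carrier G" "s \<in> S" and w': "set w' \<subseteq> carrier G \<times> S"
      using w Cons a by auto
    have e: "fr_eval H \<phi> ((x, q) # w') = \<phi> x q \<otimes>\<^bsub>H\<^esub> fr_eval H \<phi> w'" for x q
      by (simp add: fr_eval_def)
    have e2: "fr_eval H \<phi> ((x, q) # (g', s) # w') = \<phi> x q \<otimes>\<^bsub>H\<^esub> fr_eval H \<phi> ((g', s) # w')" for x q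
      by (simp add: fr_eval_def)
    have m: "\<phi> g r \<otimes>\<^bsub>H\<^esub> (\<phi> g s \<otimes>\<^bsub>H\<^esub> fr_eval H \<phi> w') = \<phi> g (r + s) \<otimes>\<^bsub>H\<^esub> fr_eval H \<phi> w'" if "g = g'"
      using that add[OF g s(2)] cl[OF g(1)] ecl[OF w'] by (simp add: m_assoc)
    have "fr_eval H \<phi> (fr_cons (g, r) w) = \<phi> g r \<otimes>\<^bsub>H\<^esub> fr_eval H \<phi> w"
      using g s ecl[OF w'] cl zero m zero[OF g(1)]
      by (auto simp: Cons a e e2 simp del: fr_cons_zero)
    moreover have "set (fr_cons (g, r) w) \<subseteq> carrier G \<times> S"
      using g s w' S(2) by (auto simp: Cons a)
    ultimately show ?thesis by blast
  qed
  have "fr_eval H \<phi> (foldr fr_cons u v) = fr_eval H \<phi> u \<otimes>\<^bsub>H\<^esub> fr_eval H \<phi> v \<and>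
        set (foldr fr_cons u v) \<subseteq> carrier G \<times> S"
    using u
  proof (induction u)
    case Nil
    then show ?case using v ecl[OF v] by (simp add: fr_eval_def)
  next
    case (Cons a u)
    obtain g r where a: "a = (g, r)" by (cases a)
    have g: "g \<in> carrier G" "r \<in> S" and u: "set u \<subseteq> carrier G \<times> S"
      using Cons.prems a by auto
    have IH: "fr_eval H \<phi> (foldr fr_cons u v) = fr_eval H \<phi> u \<otimes>\<^bsub>H\<^esub> fr_eval H \<phi> v"
      "set (foldr fr_cons u v) \<subseteq> carrier G \<times> S"
      using Cons.IH u by auto
    have "fr_eval H \<phi> (a # u) = \<phi> g r \<otimes>\<^bsub>H\<^esub> fr_eval H \<phi> u"
      by (simp add: a fr_eval_def)
    then show ?case
      using cons[OF g IH(2)] IH(1) cl[OF g(1)] ecl[OF u] ecl[OF v] by (simp add: a m_assoc)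
  qed
  then show "fr_eval H \<phi> (foldr fr_cons u v) = fr_eval H \<phi> u \<otimes>\<^bsub>H\<^esub> fr_eval H \<phi> v"
    and "set (foldr fr_cons u v) \<subseteq> carrier G \<times> S" by auto
qed

text \<open>This universal property, with \<open>group_FR\<close>, identifies \<open>FR G\<close> as the free product.\<close>

lemma fr_eval_hom:
  assumes "group H" "\<And>g r. g \<in> carrier G \<Longrightarrow> \<phi> g r \<in> carrier H"
    and "\<And>g r s. g \<in> carrier G \<Longrightarrow> \<phi> g (r + s) = \<phi> g r \<otimes>\<^bsub>H\<^esub> \<phi> g s"
  shows "fr_eval H \<phi> \<in> hom (FR G) H"
    and "g \<in> carrier G \<Longrightarrow> fr_eval H \<phi> (fr_gen g r) = \<phi> g r"
proof -
  interpret group H by fact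
  show "fr_eval H \<phi> \<in> hom (FR G) H"
  proof (rule homI)
    show "fr_eval H \<phi> x \<in> carrier H" if "x \<in> carrier (FR G)" for x
      using fr_eval_closed[OF assms(1,2) FR_letters[OF that]] .
    show "fr_eval H \<phi> (x \<otimes>\<^bsub>FR G\<^esub> y) = fr_eval H \<phi> x \<otimes>\<^bsub>H\<^esub> fr_eval H \<phi> y"
      if "x \<in> carrier (FR G)" "y \<in> carrier (FR G)" for x y
      using fr_eval_mult(1)[of H G \<phi> UNIV x y] assms FR_letters[OF that(1)] FR_letters[OF that(2)]
      by (simp add: FR_def)
  qed
  assume g: "g \<in> carrier G"
  have "\<phi> g 0 = \<one>\<^bsub>H\<^esub>"
    using assms(3)[OF g, of 0 0] assms(2)[OF g, of 0] by (metis add_0 l_cancel_one)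
  then show "fr_eval H \<phi> (fr_gen g r) = \<phi> g r"
    using assms(2)[OF g] by (simp add: fr_eval_def fr_gen_def)
qed

lemma fr_scale_hom:
  "fr_scale G t \<in> hom (FR G) (FR G)"
  "g \<in> carrier G \<Longrightarrow> fr_scale G t (fr_gen g r) = fr_gen g (t * r)"
  unfolding fr_scale_def
  by (rule fr_eval_hom; simp add: group_FR fr_gen_closed fr_gen_add distrib_left)+

lemma FZ_letters:
  assumes "w \<in> carrier (FZ G)"
  shows "w \<in> carrier (FR G)" "set w \<subseteq> carrier G \<times> \<int>"
proof -
  interpret F: group "FR G" by (rule group_FR)
  show w: "w \<in> carrier (FR G)"
    using assms F.carrier_subgroup_generated_subset unfolding FZ_def by blast
  have mult: "set (foldr fr_cons u v) \<subseteq> carrier G \<times> \<int>"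
    if "set u \<subseteq> carrier G \<times> \<int>" "set v \<subseteq> carrier G \<times> \<int>" for u v :: "('a \<times> real) list"
    using that by (intro fr_eval_mult(2)[of "FR G" G "\<lambda>g r. \<one>\<^bsub>FR G\<^esub>"]) (auto simp: group_FR)
  have inv_gen: "inv\<^bsub>FR G\<^esub> (fr_gen g 1) = fr_gen g (- 1)" if "g \<in> carrier G" for g
    by (rule F.inv_equality)
      (simp_all add: fr_gen_add fr_gen_closed that, simp add: FR_def fr_gen_def)
  have "w \<in> generate (FR G) (carrier (FR G) \<inter> {fr_gen g 1 | g. g \<in> carrier G})"
    using assms by (simp add: FZ_def carrier_subgroup_generated)
  then show "set w \<subseteq> carrier G \<times> \<int>"
  proof induction
    case one
    then show ?case by (simp add: FR_def)
  next
    case (incl h)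
    then show ?case by (auto simp: fr_gen_def)
  next
    case (inv h)
    then obtain g where g: "h = fr_gen g 1" "g \<in> carrier G" by auto
    have "set (fr_gen g (- 1)) \<subseteq> carrier G \<times> \<int>"
      using g(2) by (simp add: fr_gen_def)
    then show ?case
      using inv_gen[OF g(2)] g(1) by simp
  next
    case (eng h1 h2)
    then show ?case using mult[of h1 h2] by (simp add: FR_def)
  qed
qed

lemma fz_proj_hom:
  assumes "group G"
  shows "fz_proj G \<in> hom (FZ G) G"
    and "g \<in> carrier G \<Longrightarrow> fr_gen g 1 \<in> carrier (FZ G) \<and> fz_proj G (fr_gen g 1) = g"
proof -
  interpret group G by fact
  show "fz_proj G \<in> hom (FZ G) G"
  proof (rule homI)
    show "fz_proj G x \<in> carrier G" if "x \<in> carrier (FZ G)" for x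
      unfolding fz_proj_def using FZ_letters(2)[OF that]
      by (intro fr_eval_closed[of _ G]) (auto simp: assms)
    show "fz_proj G (x \<otimes>\<^bsub>FZ G\<^esub> y) = fz_proj G x \<otimes>\<^bsub>G\<^esub> fz_proj G y"
      if "x \<in> carrier (FZ G)" "y \<in> carrier (FZ G)" for x y
    proof -
      have "x \<otimes>\<^bsub>FZ G\<^esub> y = foldr fr_cons x y"
        by (simp add: FZ_def subgroup_generated_def FR_def)
      moreover have "fr_eval G (\<lambda>g r. g [^]\<^bsub>G\<^esub> \<lfloor>r\<rfloor>) (foldr fr_cons x y) =
          fr_eval G (\<lambda>g r. g [^]\<^bsub>G\<^esub> \<lfloor>r\<rfloor>) x \<otimes>\<^bsub>G\<^esub> fr_eval G (\<lambda>g r. g [^]\<^bsub>G\<^esub> \<lfloor>r\<rfloor>) y"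
        by (rule fr_eval_mult(1)[of _ G _ \<int>])
          (auto simp: assms FZ_letters that int_pow_mult elim!: Ints_cases
            simp flip: of_int_add dest: subsetD[OF FZ_letters(2)[OF that(1)]]
            subsetD[OF FZ_letters(2)[OF that(2)]])
      ultimately show ?thesis by (simp add: fz_proj_def)
    qed
  qed
  assume g: "g \<in> carrier G"
  have "fr_gen g 1 \<in> carrier (FZ G)"
    unfolding FZ_def carrier_subgroup_generated
    using g fr_gen_closed[OF g] by (intro generate.incl) auto
  then show "fr_gen g 1 \<in> carrier (FZ G) \<and> fz_proj G (fr_gen g 1) = g"
    using g by (simp add: fz_proj_def fr_eval_def fr_gen_def)
qed

end

theory Submission
  imports Defs
begin

text \<open>
  For an ample scaling set the dilations can be written down on representatives. Choose
  \<open>\<sigma>: T \<rightarrow> T\<close> with \<open>\<sigma> t / t \<longlonglongrightarrow> s > 0\<close> and send a direction \<open>w\<close> to \<open>w \<circ> \<sigma>\<close>. Writing \<open>\<psi> a\<close> for the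
  scaling of the free product, the family that represents \<open>w \<circ> \<sigma>\<close> is
  \<open>\<psi> (1 / t) (w (\<sigma> t)) = \<psi> (\<sigma> t / t) (\<psi> (1 / \<sigma> t) (w (\<sigma> t)))\<close>. Since \<open>\<psi> (1 / t) (w t)\<close> is
  Cauchy and \<open>\<sigma>\<close> tends to infinity, this is asymptotic to \<open>\<psi> s (\<psi> (1 / t) (w t))\<close>
  (\<open>reparametrized_approx\<close>). Therefore \<open>w \<circ> \<sigma>\<close> represents the dilation of \<open>w\<close> by \<open>s\<close>,
  independently of the choice of \<open>\<sigma>\<close>. Negative scalars are covered by composing with \<open>\<psi> (-1)\<close>,
  which preserves integrality of exponents, and the scalar 0 by \<open>\<psi> 0\<close> (\<open>dil\<close>). On the classes of
  the constant directions \<open>iota x\<close>, which are dense, this agrees with \<open>\<psi> s\<close>, so it is the map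
  \<open>dilation\<close> (\<open>dilation_eq\<close>).

  The gain is that \<open>w \<mapsto> w \<circ> \<sigma>\<close> commutes with the pointwise projection to \<open>G\<close>: it lies over
  \<open>g \<mapsto> g \<circ> \<sigma>\<close> (\<open>push_dil\<close>). A lift \<open>w\<close> of \<open>g\<close> gives the lift \<open>w \<circ> \<sigma>\<close> of \<open>g \<circ> \<sigma>\<close>, of norm
  \<open>s\<close> times that of \<open>w\<close>, so the norm of \<open>g \<circ> \<sigma>\<close> is at most \<open>s\<close> times that of \<open>g\<close>. In particular
  the map descends to the cone, and the dilation by \<open>1 / s\<close> gives the reverse inequality. The laws of
  the action on the cone are images of those for directions (\<open>dilated_image\<close>). Joint continuity
  follows from the Lipschitz bounds and continuity of single orbits (\<open>descent_continuous\<close>), and the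
  latter reduces by density to the orbits of words under \<open>\<psi>\<close> (\<open>dil_orbit_bound\<close>).

  The scalars from 1 down to 0 contract the cone to its unit. Composing this contraction with
  endomorphisms contracts the space of continuous endomorphisms to the trivial one; it stays
  within homomorphisms because every dilation is a homomorphism (\<open>contractible_space_End\<close>).
\<close>

section \<open>Groups with a conjugation-invariant pseudonorm\<close>

text \<open>Three groups carry pseudonorms that arise as infima or as limits: the free product, the group of
  directions, and the group of functions underlying the cone. For infima it is the inequalities
  for inverses and conjugates that come naturally, and the equalities follow from them.\<close>

locale pseudonormed_group = group K for K (structure) +
  fixes P :: "'a \<Rightarrow> real"
  assumes nonneg: "x \<in> carrier K \<Longrightarrow> 0 \<le> P x"
    and P_one: "P \<one> = 0"
    and P_inv_le: "x \<in> carrier K \<Longrightarrow> P (inv x) \<le> P x"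
    and P_mult: "x \<in> carrier K \<Longrightarrow> y \<in> carrier K \<Longrightarrow> P (x \<otimes> y) \<le> P x + P y"
    and P_conj_le: "x \<in> carrier K \<Longrightarrow> h \<in> carrier K \<Longrightarrow> P (h \<otimes> x \<otimes> inv h) \<le> P x"
begin

abbreviation \<delta> :: "'a \<Rightarrow> 'a \<Rightarrow> real" where "\<delta> \<equiv> group_dist K P"

lemma delta_eq: "x \<in> carrier K \<Longrightarrow> y \<in> carrier K \<Longrightarrow> \<delta> x y = P (inv x \<otimes> y)"
  by (simp add: group_dist_def)

lemma cancel_inv [simp]:
  assumes "x \<in> carrier K" "z \<in> carrier K"
  shows "x \<otimes> (inv x \<otimes> z) = z" "inv x \<otimes> (x \<otimes> z) = z"
  using assms by (simp_all flip: m_assoc)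

lemma P_inv: "x \<in> carrier K \<Longrightarrow> P (inv x) = P x"
  by (metis P_inv_le inv_closed inv_inv order_antisym)

lemma P_conj: "x \<in> carrier K \<Longrightarrow> h \<in> carrier K \<Longrightarrow> P (h \<otimes> x \<otimes> inv h) = P x"
proof (rule antisym[OF P_conj_le])
  assume "x \<in> carrier K" "h \<in> carrier K"
  moreover from this have "x = inv h \<otimes> (h \<otimes> x \<otimes> inv h) \<otimes> inv (inv h)"
    by (simp add: m_assoc)
  ultimately show "P x \<le> P (h \<otimes> x \<otimes> inv h)"
    by (metis P_conj_le inv_closed m_closed)
qed

lemma P_commute: "x \<in> carrier K \<Longrightarrow> y \<in> carrier K \<Longrightarrow> P (x \<otimes> y) = P (y \<otimes> x)"
  using P_conj[of "y \<otimes> x" x] by (simp add: m_assoc)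

lemma delta_nonneg: "0 \<le> \<delta> x y"
  by (simp add: group_dist_def nonneg)

lemma delta_refl [simp]: "\<delta> x x = 0"
  by (simp add: group_dist_def P_one)

lemma delta_sym: "\<delta> x y = \<delta> y x"
  using P_inv[of "inv x \<otimes> y"] by (auto simp: group_dist_def inv_mult_group)

lemma delta_one: "x \<in> carrier K \<Longrightarrow> \<delta> \<one> x = P x"
  by (simp add: delta_eq)

lemma delta_triangle:
  assumes "x \<in> carrier K" "y \<in> carrier K" "z \<in> carrier K"
  shows "\<delta> x z \<le> \<delta> x y + \<delta> y z"
proof -
  have "inv x \<otimes> z = (inv x \<otimes> y) \<otimes> (inv y \<otimes> z)"
    using assms by (simp add: m_assoc)
  then show ?thesis using assms P_mult[of "inv x \<otimes> y" "inv y \<otimes> z"] by (simp add: delta_eq)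
qed

text \<open>Bi-invariance of the distance: conjugating the first quotient by the second factor separates
  the two contributions.\<close>

lemma delta_mult:
  assumes "x \<in> carrier K" "y \<in> carrier K" "x' \<in> carrier K" "y' \<in> carrier K"
  shows "\<delta> (x \<otimes> y) (x' \<otimes> y') \<le> \<delta> x x' + \<delta> y y'"
proof -
  have "inv (x \<otimes> y) \<otimes> (x' \<otimes> y') = (inv y \<otimes> (inv x \<otimes> x') \<otimes> inv (inv y)) \<otimes> (inv y \<otimes> y')"
    using assms by (simp add: m_assoc inv_mult_group)
  then show ?thesis
    using assms P_mult[of "inv y \<otimes> (inv x \<otimes> x') \<otimes> inv (inv y)" "inv y \<otimes> y'"]
      P_conj[of "inv x \<otimes> x'" "inv y"]
    by (simp add: delta_eq)
qed

lemma delta_inv: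
  assumes "x \<in> carrier K" "y \<in> carrier K"
  shows "\<delta> (inv x) (inv y) = \<delta> x y"
  using assms P_commute[of x "inv y"] delta_sym[of x y] by (simp add: delta_eq)

lemma P_delta:
  assumes "x \<in> carrier K" "y \<in> carrier K"
  shows "\<bar>P x - P y\<bar> \<le> \<delta> x y"
  using delta_triangle[of \<one> x y] delta_triangle[of \<one> y x] assms
  by (simp add: delta_one delta_sym[of y x])

lemma P_cong: "x \<in> carrier K \<Longrightarrow> y \<in> carrier K \<Longrightarrow> \<delta> x y = 0 \<Longrightarrow> P x = P y"
  using P_delta[of x y] by simp

lemma delta_cong:
  assumes "x \<in> carrier K" "y \<in> carrier K" "x' \<in> carrier K" "y' \<in> carrier K"
    and "\<delta> x x' = 0" "\<delta> y y' = 0"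
  shows "\<delta> x y = \<delta> x' y'"
  using delta_triangle[of x x' y] delta_triangle[of x' y' y]
    delta_triangle[of x' x y'] delta_triangle[of x y y'] assms
  by (simp add: delta_sym[of y' y] delta_sym[of x' x])

lemma hom_contracts_delta:
  assumes "pseudonormed_group L Q" "\<phi> \<in> hom K L"
    and "\<And>x. x \<in> carrier K \<Longrightarrow> Q (\<phi> x) \<le> c * P x" "x \<in> carrier K" "y \<in> carrier K"
  shows "group_dist L Q (\<phi> x) (\<phi> y) \<le> c * \<delta> x y"
proof -
  interpret L: pseudonormed_group L Q by fact
  interpret \<phi>: group_hom K L \<phi> by unfold_locales (fact assms(2))
  have "inv\<^bsub>L\<^esub> (\<phi> x) \<otimes>\<^bsub>L\<^esub> \<phi> y = \<phi> (inv x \<otimes> y)" using assms by simp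
  then show ?thesis
    using assms(3)[of "inv x \<otimes> y"] assms by (simp add: delta_eq L.delta_eq)
qed

lemma normal_null_set: "null_set K P \<lhd> K"
proof (rule normal_invI)
  show "subgroup (null_set K P) K"
  proof
    show "x \<otimes> y \<in> null_set K P" if "x \<in> null_set K P" "y \<in> null_set K P" for x y
      using that P_mult[of x y] nonneg[of "x \<otimes> y"] by (auto simp: null_set_def)
  qed (auto simp: null_set_def P_one P_inv)
  show "\<And>h x. h \<in> carrier K \<Longrightarrow> x \<in> null_set K P \<Longrightarrow> h \<otimes> x \<otimes> inv h \<in> null_set K P"
    by (simp add: null_set_def P_conj)
qed

lemma null_class_eq:
  assumes x: "x \<in> carrier K"
  shows "null_class K P x = {y \<in> carrier K. \<delta> x y = 0}"
proof -
  interpret N: normal "null_set K P" K by (rule normal_null_set)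
  have sub: "null_class K P x \<subseteq> carrier K"
    unfolding null_class_def using r_coset_subset_G[OF N.subset x] .
  have "y \<in> null_class K P x \<longleftrightarrow> \<delta> x y = 0" if y: "y \<in> carrier K" for y
  proof -
    have "P (inv x \<otimes> y) = P (y \<otimes> inv x)" using P_commute x y by simp
    then have "y \<otimes> inv x \<in> null_set K P \<longleftrightarrow> \<delta> x y = 0"
      unfolding null_set_def delta_eq[OF x y] using x y by simp
    then show ?thesis
      unfolding null_class_def N.rcos_module[OF is_group x y] .
  qed
  with sub show ?thesis by blast
qed

lemma null_class_eq_iff:
  assumes "x \<in> carrier K" "y \<in> carrier K"
  shows "null_class K P x = null_class K P y \<longleftrightarrow> \<delta> x y = 0"
proof
  assume "null_class K P x = null_class K P y"
  then have "y \<in> null_class K P x" using assms by (simp add: null_class_eq)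
  then show "\<delta> x y = 0" using assms by (simp add: null_class_eq)
next
  assume "\<delta> x y = 0"
  then have "\<delta> x z = \<delta> y z" if "z \<in> carrier K" for z
    by (rule delta_cong[OF assms(1) that assms(2) that]) (simp_all add: \<open>\<delta> x y = 0\<close>)
  then show "null_class K P x = null_class K P y"
    unfolding null_class_eq[OF assms(1)] null_class_eq[OF assms(2)] by metis
qed

text \<open>Maps on the quotient pick the common value on a class with \<open>the_elem\<close>; constancy on
  pseudodistance zero is what makes them well defined.\<close>

lemma the_elem_null_class:
  assumes x: "x \<in> carrier K" and f: "\<And>y. y \<in> carrier K \<Longrightarrow> \<delta> x y = 0 \<Longrightarrow> f y = f x"
  shows "the_elem (f ` null_class K P x) = f x"
proof -
  have "x \<in> null_class K P x" using x by (simp add: null_class_eq)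
  moreover have "f y = f x" if "y \<in> null_class K P x" for y
    using f[of y] that x by (simp add: null_class_eq)
  ultimately have "f ` null_class K P x = {f x}" by blast
  then show ?thesis by simp
qed

lemma induced_norm_class: "x \<in> carrier K \<Longrightarrow> induced_norm P (null_class K P x) = P x"
  unfolding induced_norm_def by (rule the_elem_null_class) (metis P_cong)+

abbreviation "Q \<equiv> null_quotient K P"

lemma carrier_quotient: "carrier Q = null_class K P ` carrier K"
  by (auto simp: null_quotient_def FactGroup_def RCOSETS_def null_class_def)

lemma class_closed: "x \<in> carrier K \<Longrightarrow> null_class K P x \<in> carrier Q"
  by (simp add: carrier_quotient)

lemma group_quotient: "group Q"
  unfolding null_quotient_def by (rule normal.factorgroup_is_group[OF normal_null_set])

lemma class_hom: "null_class K P \<in> hom K Q"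
  using normal.r_coset_hom_Mod[OF normal_null_set]
  unfolding null_class_def[abs_def] null_quotient_def .

lemma class_mult:
  "x \<in> carrier K \<Longrightarrow> y \<in> carrier K \<Longrightarrow>
    null_class K P x \<otimes>\<^bsub>Q\<^esub> null_class K P y = null_class K P (x \<otimes> y)"
  using hom_mult[OF class_hom] by simp

lemma class_one: "\<one>\<^bsub>Q\<^esub> = null_class K P \<one>"
  using hom_one[OF class_hom group_axioms group_quotient] by simp

lemma class_inv: "x \<in> carrier K \<Longrightarrow> inv\<^bsub>Q\<^esub> (null_class K P x) = null_class K P (inv x)"
  by (metis class_hom group_axioms group_hom.hom_inv group_hom_axioms.intro group_hom_def
      group_quotient)

lemma delta_class:
  "x \<in> carrier K \<Longrightarrow> y \<in> carrier K \<Longrightarrow>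
    group_dist Q (induced_norm P) (null_class K P x) (null_class K P y) = \<delta> x y"
  by (simp add: group_dist_def carrier_quotient class_inv class_mult induced_norm_class)

lemma metric_quotient: "Metric_space (carrier Q) (group_dist Q (induced_norm P))"
proof
  let ?d = "group_dist Q (induced_norm P)"
  show "0 \<le> ?d X Y" for X Y
  proof (cases "X \<in> carrier Q \<and> Y \<in> carrier Q")
    case True
    then show ?thesis by (auto simp: carrier_quotient delta_class delta_nonneg)
  qed (auto simp: group_dist_def)
  show "?d X Y = ?d Y X" for X Y
  proof (cases "X \<in> carrier Q \<and> Y \<in> carrier Q")
    case True
    then show ?thesis by (auto simp: carrier_quotient delta_class intro: delta_sym)
  qed (auto simp: group_dist_def)
  show "?d X Y = 0 \<longleftrightarrow> X = Y" if "X \<in> carrier Q" "Y \<in> carrier Q" for X Y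
    using that by (auto simp: carrier_quotient delta_class simp flip: null_class_eq_iff)
  show "?d X Z \<le> ?d X Y + ?d Y Z" if "X \<in> carrier Q" "Y \<in> carrier Q" "Z \<in> carrier Q" for X Y Z
    using that by (auto simp: carrier_quotient delta_class delta_triangle)
qed

end

text \<open>The quotient pseudonorm along an epimorphism. The infimum need not be attained, so each
  axiom is proved up to \<open>\<epsilon>\<close> by choosing nearly optimal preimages.\<close>

lemma pseudonormed_image:
  assumes P: "pseudonormed_group K P" and C: "group C" and \<pi>: "\<pi> \<in> hom K C"
    and onto: "\<pi> ` carrier K = carrier C"
    and R: "\<And>c. R c = Inf {P w | w. w \<in> carrier K \<and> \<pi> w = c}"
  shows "pseudonormed_group C R"
    and "\<And>w. w \<in> carrier K \<Longrightarrow> R (\<pi> w) \<le> P w"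
    and "\<And>c \<epsilon>. c \<in> carrier C \<Longrightarrow> 0 < \<epsilon> \<Longrightarrow> \<exists>w\<in>carrier K. \<pi> w = c \<and> P w < R c + \<epsilon>"
proof -
  interpret P: pseudonormed_group K P by fact
  interpret C: group C by fact
  interpret \<pi>: group_hom K C \<pi> by unfold_locales (fact \<pi>)
  have bdd: "bdd_below {P w | w. w \<in> carrier K \<and> \<pi> w = c}" for c
    by (rule bdd_belowI[of _ 0]) (auto simp: P.nonneg)
  show le: "R (\<pi> w) \<le> P w" if "w \<in> carrier K" for w
    unfolding R by (rule cInf_lower[OF _ bdd]) (use that in blast)
  have ne: "{P w | w. w \<in> carrier K \<and> \<pi> w = c} \<noteq> {}" if "c \<in> carrier C" for c
    using that unfolding onto[symmetric] by blast
  show ex: "\<exists>w\<in>carrier K. \<pi> w = c \<and> P w < R c + \<epsilon>" if "c \<in> carrier C" "0 < \<epsilon>" for c \<epsilon>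
    using cInf_lessD[OF ne[OF that(1)], of "R c + \<epsilon>"] that(2) R by auto
  show "pseudonormed_group C R"
  proof
    show nn: "0 \<le> R c" if "c \<in> carrier C" for c
      unfolding R by (rule cInf_greatest[OF ne[OF that]]) (auto simp: P.nonneg)
    show "R \<one>\<^bsub>C\<^esub> = 0"
      using le[of "\<one>\<^bsub>K\<^esub>"] nn[of "\<one>\<^bsub>C\<^esub>"] by (simp add: P.P_one)
    show "R (inv\<^bsub>C\<^esub> c) \<le> R c" if c: "c \<in> carrier C" for c
    proof (rule field_le_epsilon)
      fix \<epsilon> :: real assume "0 < \<epsilon>"
      then obtain w where "w \<in> carrier K" "\<pi> w = c" "P w < R c + \<epsilon>"
        using ex[OF c] by metis
      moreover from this have "\<pi> (inv\<^bsub>K\<^esub> w) = inv\<^bsub>C\<^esub> c" by auto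
      ultimately show "R (inv\<^bsub>C\<^esub> c) \<le> R c + \<epsilon>" using le[of "inv\<^bsub>K\<^esub> w"] by (simp add: P.P_inv)
    qed
    show "R (h \<otimes>\<^bsub>C\<^esub> c \<otimes>\<^bsub>C\<^esub> inv\<^bsub>C\<^esub> h) \<le> R c" if c: "c \<in> carrier C" and h: "h \<in> carrier C" for c h
    proof (rule field_le_epsilon)
      fix \<epsilon> :: real assume "0 < \<epsilon>"
      then obtain w where "w \<in> carrier K" "\<pi> w = c" "P w < R c + \<epsilon>"
        using ex[OF c] by metis
      moreover obtain v where "v \<in> carrier K" "\<pi> v = h" using h unfolding onto[symmetric] by blast
      ultimately show "R (h \<otimes>\<^bsub>C\<^esub> c \<otimes>\<^bsub>C\<^esub> inv\<^bsub>C\<^esub> h) \<le> R c + \<epsilon>"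
        using le[of "v \<otimes>\<^bsub>K\<^esub> w \<otimes>\<^bsub>K\<^esub> inv\<^bsub>K\<^esub> v"] by (simp add: P.P_conj)
    qed
    show "R (c \<otimes>\<^bsub>C\<^esub> e) \<le> R c + R e" if c: "c \<in> carrier C" and e: "e \<in> carrier C" for c e
    proof (rule field_le_epsilon)
      fix \<epsilon> :: real assume \<epsilon>: "0 < \<epsilon>"
      obtain w where "w \<in> carrier K" "\<pi> w = c" "P w < R c + \<epsilon> / 2"
        using ex[OF c, of "\<epsilon> / 2"] \<epsilon> by auto
      moreover obtain v where "v \<in> carrier K" "\<pi> v = e" "P v < R e + \<epsilon> / 2"
        using ex[OF e, of "\<epsilon> / 2"] \<epsilon> by auto
      ultimately show "R (c \<otimes>\<^bsub>C\<^esub> e) \<le> R c + R e + \<epsilon>"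
        using le[of "w \<otimes>\<^bsub>K\<^esub> v"] P.P_mult[of w v] by simp
    qed
  qed
qed

section \<open>One-parameter families of dilations\<close>

text \<open>An action of a multiplicative set of scalars by endomorphisms that scale the pseudonorm. The
  action laws hold only up to pseudodistance zero, because the endomorphisms used later depend on
  choices that are compatible with products only in the limit; in the quotient they become
  equations. An upper bound on the norm suffices as an axiom: the inverse scalar gives the reverse
  inequality.\<close>

locale dilated_group = pseudonormed_group K P for K (structure) and P +
  fixes S :: "real set" and H :: "real \<Rightarrow> 'a \<Rightarrow> 'a"
  assumes S_one: "1 \<in> S" and S_zero: "0 \<in> S"
    and S_mult: "s \<in> S \<Longrightarrow> t \<in> S \<Longrightarrow> s * t \<in> S"
    and S_inverse: "s \<in> S \<Longrightarrow> inverse s \<in> S"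
    and H_hom: "s \<in> S \<Longrightarrow> H s \<in> hom K K"
    and H_le: "s \<in> S \<Longrightarrow> x \<in> carrier K \<Longrightarrow> P (H s x) \<le> \<bar>s\<bar> * P x"
    and H_one: "x \<in> carrier K \<Longrightarrow> \<delta> (H 1 x) x = 0"
    and H_mult: "s \<in> S \<Longrightarrow> t \<in> S \<Longrightarrow> x \<in> carrier K \<Longrightarrow> \<delta> (H s (H t x)) (H (s * t) x) = 0"
    and H_cont: "s \<in> S \<Longrightarrow> x \<in> carrier K \<Longrightarrow> ((\<lambda>t. \<delta> (H s x) (H t x)) \<longlongrightarrow> 0) (at s within S)"
begin

lemma H_closed: "s \<in> S \<Longrightarrow> x \<in> carrier K \<Longrightarrow> H s x \<in> carrier K"
  by (rule hom_in_carrier[OF H_hom])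

lemma H_norm:
  assumes s: "s \<in> S" and x: "x \<in> carrier K"
  shows "P (H s x) = \<bar>s\<bar> * P x"
proof (cases "s = 0")
  case True
  then show ?thesis using H_le[OF s x] nonneg[OF H_closed[OF s x]] by simp
next
  case False
  note i = S_inverse[OF s] and Hx = H_closed[OF s x]
  have "P x = P (H 1 x)"
    using P_cong[OF H_closed[OF S_one x] x H_one[OF x]] by simp
  also have "\<dots> = P (H (inverse s) (H s x))"
    using P_cong[OF H_closed[OF i Hx] H_closed[OF S_mult[OF i s] x] H_mult[OF i s x]] False by simp
  also have "\<dots> \<le> P (H s x) / \<bar>s\<bar>"
    using H_le[OF i Hx] by (simp add: divide_inverse mult.commute)
  finally show ?thesis
    using H_le[OF s x] False by (simp add: field_simps)
qed

lemma H_delta: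
  assumes "s \<in> S" "x \<in> carrier K" "y \<in> carrier K"
  shows "\<delta> (H s x) (H s y) \<le> \<bar>s\<bar> * \<delta> x y"
  using hom_contracts_delta[OF pseudonormed_group_axioms H_hom[OF assms(1)] H_le[OF assms(1)]] assms
  by simp

definition descent :: "real \<times> 'a set \<Rightarrow> 'a set" where
  "descent = (\<lambda>(s, X). the_elem ((\<lambda>x. null_class K P (H s x)) ` X))"

lemma descent_class:
  assumes s: "s \<in> S" and x: "x \<in> carrier K"
  shows "descent (s, null_class K P x) = null_class K P (H s x)"
proof -
  have "null_class K P (H s y) = null_class K P (H s x)" if y: "y \<in> carrier K" "\<delta> x y = 0" for y
  proof -
    have "\<delta> (H s x) (H s y) = 0"
      using H_delta[OF s x y(1)] y(2) delta_nonneg[of "H s x" "H s y"] by simp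
    then show ?thesis
      using null_class_eq_iff[OF H_closed[OF s x] H_closed[OF s y(1)]] by simp
  qed
  then show ?thesis
    unfolding descent_def prod.case by (rule the_elem_null_class[OF x])
qed

lemma descent_closed: "s \<in> S \<Longrightarrow> X \<in> carrier Q \<Longrightarrow> descent (s, X) \<in> carrier Q"
  by (auto simp: carrier_quotient descent_class H_closed)

lemma descent_hom:
  assumes s: "s \<in> S"
  shows "(\<lambda>X. descent (s, X)) \<in> hom Q Q"
proof (rule homI)
  show "descent (s, X \<otimes>\<^bsub>Q\<^esub> Y) = descent (s, X) \<otimes>\<^bsub>Q\<^esub> descent (s, Y)"
    if "X \<in> carrier Q" "Y \<in> carrier Q" for X Y
    using that s H_closed[OF s] hom_mult[OF H_hom[OF s]]
    by (auto simp: carrier_quotient class_mult descent_class)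
qed (rule descent_closed[OF s])

lemma descent_norm:
  "s \<in> S \<Longrightarrow> X \<in> carrier Q \<Longrightarrow> induced_norm P (descent (s, X)) = \<bar>s\<bar> * induced_norm P X"
  by (auto simp: carrier_quotient descent_class induced_norm_class H_closed H_norm)

lemma descent_one: "X \<in> carrier Q \<Longrightarrow> descent (1, X) = X"
  using null_class_eq_iff[THEN iffD2, OF H_closed[OF S_one] _ H_one]
  by (auto simp: carrier_quotient descent_class S_one)

lemma descent_mult:
  "s \<in> S \<Longrightarrow> t \<in> S \<Longrightarrow> X \<in> carrier Q \<Longrightarrow> descent (s, descent (t, X)) = descent (s * t, X)"
  using null_class_eq_iff[THEN iffD2, OF _ _ H_mult]
  by (auto simp: carrier_quotient descent_class H_closed S_mult)

lemma descent_zero: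
  assumes "X \<in> carrier Q"
  shows "descent (0, X) = \<one>\<^bsub>Q\<^esub>"
proof -
  obtain x where x: "x \<in> carrier K" "X = null_class K P x"
    using assms by (auto simp: carrier_quotient)
  have "\<delta> (H 0 x) \<one> = 0"
    using x H_norm[OF S_zero x(1)] H_closed[OF S_zero x(1)] delta_one delta_sym[of \<one>] by simp
  then show ?thesis
    using x H_closed[OF S_zero x(1)] by (simp add: descent_class S_zero class_one null_class_eq_iff)
qed

text \<open>Joint continuity combines continuity along each orbit with the Lipschitz bound
  \<open>\<bar>s\<bar>\<close> for the dilation by \<open>s\<close>, which is locally bounded in \<open>s\<close>.\<close>

lemma descent_continuous:
  "continuous_map (prod_topology (top_of_set S) (group_topology Q (induced_norm P)))
     (group_topology Q (induced_norm P)) descent"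
proof -
  interpret M: Metric_space "carrier Q" "group_dist Q (induced_norm P)" by (rule metric_quotient)
  show ?thesis
    unfolding group_topology_def M.continuous_map_to_metric
  proof (intro ballI allI impI)
    fix z and \<epsilon> :: real
    assume z: "z \<in> topspace (prod_topology (top_of_set S) M.mtopology)" and \<epsilon>: "0 < \<epsilon>"
    then obtain s X where "z = (s, X)" and s: "s \<in> S" and "X \<in> carrier Q"
      by auto
    then obtain x where zs: "z = (s, null_class K P x)" and x: "x \<in> carrier K"
      unfolding carrier_quotient by blast
    have ev: "\<forall>\<^sub>F t in at s within S. \<delta> (H s x) (H t x) < \<epsilon> / 2"
      using H_cont[OF s x] \<epsilon> by (intro order_tendstoD) auto
    obtain r where r: "0 < r" "\<And>t. t \<in> S \<Longrightarrow> dist t s < r \<Longrightarrow> \<delta> (H s x) (H t x) < \<epsilon> / 2"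
    proof -
      obtain r where "0 < r" and r: "\<And>t. t \<in> S \<Longrightarrow> t \<noteq> s \<Longrightarrow> dist t s < r \<Longrightarrow> \<delta> (H s x) (H t x) < \<epsilon> / 2"
        using ev unfolding eventually_at by blast
      have "\<delta> (H s x) (H t x) < \<epsilon> / 2" if "t \<in> S" "dist t s < r" for t
        using r[OF that(1) _ that(2)] \<epsilon> by (cases "t = s") simp_all
      with \<open>0 < r\<close> show ?thesis by (rule that)
    qed
    \<comment> \<open>a Lipschitz constant that serves for all dilations by scalars within distance 1 of \<open>s\<close>\<close>
    define c where "c = \<bar>s\<bar> + 1"
    define U where "U = (S \<inter> ball s (min r 1)) \<times> M.mball (null_class K P x) (\<epsilon> / (2 * c))"
    have c: "0 < c" by (simp add: c_def)
    show "\<exists>U. openin (prod_topology (top_of_set S) M.mtopology) U \<and> z \<in> U \<and>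
            (\<forall>y\<in>U. descent y \<in> M.mball (descent z) \<epsilon>)"
    proof (intro exI[of _ U] conjI ballI)
      show "openin (prod_topology (top_of_set S) M.mtopology) U"
        unfolding U_def by (intro openin_prod_Times_iff[THEN iffD2] disjI2 conjI) auto
      show "z \<in> U" using s x r(1) c \<epsilon> by (auto simp: zs U_def class_closed)
      fix z' assume "z' \<in> U"
      then obtain t Y where "z' = (t, Y)" and t: "t \<in> S" "dist t s < r" "dist t s < 1"
        and Y: "Y \<in> carrier Q" "group_dist Q (induced_norm P) (null_class K P x) Y < \<epsilon> / (2 * c)"
        by (auto simp: U_def dist_commute)
      then obtain y where z': "z' = (t, null_class K P y)" and y: "y \<in> carrier K"
        and xy: "\<delta> x y < \<epsilon> / (2 * c)"
        using x by (auto simp: carrier_quotient delta_class)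
      have "\<bar>t\<bar> \<le> c" using t(3) by (auto simp: c_def dist_real_def)
      then have "\<delta> (H t x) (H t y) \<le> c * \<delta> x y"
        using H_delta[OF t(1) x y] delta_nonneg[of x y] by (meson mult_right_mono order_trans)
      also have "\<dots> < \<epsilon> / 2" using xy c by (simp add: field_simps)
      finally have "\<delta> (H s x) (H t y) < \<epsilon>"
        using delta_triangle[OF H_closed[OF s x] H_closed[OF t(1) x] H_closed[OF t(1) y]]
          r(2)[OF t(1,2)] by simp
      then show "descent z' \<in> M.mball (descent z) \<epsilon>"
        using s x t y by (simp add: zs z' descent_class delta_class H_closed class_closed)
    qed
  qed
qed

end

text \<open>If \<open>H'\<close> is induced by \<open>H\<close> through an epimorphism \<open>\<pi>\<close>, then every preimage \<open>w\<close> of \<open>x\<close>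
  yields the preimage \<open>H s w\<close> of \<open>H' s x\<close>, so the quotient pseudonorm grows at most by the
  factor \<open>\<bar>s\<bar>\<close>; all other axioms are images of those for \<open>H\<close>. The set of scalars may shrink,
  as only some of the maps \<open>H s\<close> need to be compatible with \<open>\<pi>\<close>.\<close>

lemma dilated_image:
  assumes D: "dilated_group K P S H" and C: "group C" and \<pi>: "\<pi> \<in> hom K C"
    and onto: "\<pi> ` carrier K = carrier C"
    and R: "\<And>c. R c = Inf {P w | w. w \<in> carrier K \<and> \<pi> w = c}"
    and S': "S' \<subseteq> S" "1 \<in> S'" "0 \<in> S'" "\<And>s t. s \<in> S' \<Longrightarrow> t \<in> S' \<Longrightarrow> s * t \<in> S'"
      "\<And>s. s \<in> S' \<Longrightarrow> inverse s \<in> S'"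
    and H': "\<And>s w. s \<in> S' \<Longrightarrow> w \<in> carrier K \<Longrightarrow> H' s (\<pi> w) = \<pi> (H s w)"
  shows "dilated_group C R S' H'"
proof -
  interpret D: dilated_group K P S H by fact
  note im = pseudonormed_image[OF D.pseudonormed_group_axioms C \<pi> onto R]
  interpret C: pseudonormed_group C R by (rule im(1))
  have le: "C.\<delta> (\<pi> x) (\<pi> y) \<le> D.\<delta> x y" if "x \<in> carrier K" "y \<in> carrier K" for x y
    using D.hom_contracts_delta[OF im(1) \<pi>, of 1 x y] im(2) that by simp
  have le0: "C.\<delta> (\<pi> x) (\<pi> y) = 0" if "x \<in> carrier K" "y \<in> carrier K" "D.\<delta> x y = 0" for x y
    using le[OF that(1,2)] that(3) C.delta_nonneg[of "\<pi> x" "\<pi> y"] by simp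
  have ex: "\<exists>w\<in>carrier K. c = \<pi> w" if "c \<in> carrier C" for c
    using that unfolding onto[symmetric] by blast
  have cl: "H s w \<in> carrier K" if "s \<in> S'" "w \<in> carrier K" for s w
    using D.H_closed that S'(1) by blast
  have \<pi>cl: "\<pi> w \<in> carrier C" if "w \<in> carrier K" for w
    using that onto by blast
  show ?thesis
  proof
    fix s x assume s: "s \<in> S'" and x: "x \<in> carrier C"
    have sS: "s \<in> S" using s S'(1) by blast
    show "R (H' s x) \<le> \<bar>s\<bar> * R x"
    proof (rule field_le_epsilon)
      fix \<epsilon> :: real assume \<epsilon>: "0 < \<epsilon>"
      define \<eta> where "\<eta> = \<epsilon> / (\<bar>s\<bar> + 1)"
      have "0 < \<eta>" using \<epsilon> by (simp add: \<eta>_def)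
      then obtain w where w: "w \<in> carrier K" "\<pi> w = x" "P w < R x + \<eta>"
        using im(3)[OF x] by metis
      have "R (H' s x) \<le> P (H s w)"
        using H'[OF s w(1)] im(2)[OF cl[OF s w(1)]] w(2) by simp
      also have "\<dots> \<le> \<bar>s\<bar> * P w" by (rule D.H_le[OF sS w(1)])
      also have "\<dots> \<le> \<bar>s\<bar> * (R x + \<eta>)" using w(3) by (intro mult_left_mono) auto
      also have "\<dots> \<le> \<bar>s\<bar> * R x + \<epsilon>"
        using \<epsilon> by (simp add: \<eta>_def field_simps)
      finally show "R (H' s x) \<le> \<bar>s\<bar> * R x + \<epsilon>" .
    qed
    obtain w where w: "w \<in> carrier K" "x = \<pi> w" using ex[OF x] by blast
    have "\<forall>\<^sub>F t in at s within S'. C.\<delta> (H' s x) (H' t x) \<le> D.\<delta> (H s w) (H t w)"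
    proof -
      have "C.\<delta> (H' s x) (H' t x) \<le> D.\<delta> (H s w) (H t w)" if t: "t \<in> S'" for t
        unfolding w(2) H'[OF s w(1)] H'[OF t w(1)] using le cl s t w(1) by simp
      then show ?thesis unfolding eventually_at_filter by (intro always_eventually) blast
    qed
    moreover have "((\<lambda>t. D.\<delta> (H s w) (H t w)) \<longlongrightarrow> 0) (at s within S')"
      using D.H_cont[OF sS w(1)] S'(1) by (rule tendsto_within_subset)
    ultimately show "((\<lambda>t. C.\<delta> (H' s x) (H' t x)) \<longlongrightarrow> 0) (at s within S')"
      by (rule tendsto_sandwich[OF always_eventually _ tendsto_const, rotated])
        (simp add: C.delta_nonneg)
  next
    fix s assume s: "s \<in> S'"
    then have hom: "H s \<in> hom K K" using D.H_hom S'(1) by blast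
    show "H' s \<in> hom C C"
    proof (rule homI)
      fix x y assume "x \<in> carrier C" "y \<in> carrier C"
      then obtain v w where "v \<in> carrier K" "x = \<pi> v" "w \<in> carrier K" "y = \<pi> w"
        using ex by metis
      then show "H' s (x \<otimes>\<^bsub>C\<^esub> y) = H' s x \<otimes>\<^bsub>C\<^esub> H' s y"
        using H'[OF s] cl[OF s] hom_mult[OF \<pi>] hom_mult[OF hom]
        by (metis D.m_closed)
    next
      fix x assume "x \<in> carrier C"
      then obtain v where "v \<in> carrier K" "x = \<pi> v" using ex by metis
      then show "H' s x \<in> carrier C" using H'[OF s] cl[OF s] \<pi>cl by metis
    qed
  next
    fix x assume "x \<in> carrier C"
    then obtain w where w: "w \<in> carrier K" "x = \<pi> w" using ex by metis
    then show "C.\<delta> (H' 1 x) x = 0"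
      using H'[OF S'(2) w(1)] le0[OF cl[OF S'(2) w(1)] w(1) D.H_one[OF w(1)]] by simp
    fix s t assume st: "s \<in> S'" "t \<in> S'"
    note tw = cl[OF st(2) w(1)]
    have "D.\<delta> (H s (H t w)) (H (s * t) w) = 0"
      using D.H_mult st w S'(1) by blast
    then have "C.\<delta> (\<pi> (H s (H t w))) (\<pi> (H (s * t) w)) = 0"
      by (rule le0[OF cl[OF st(1) tw] cl[OF S'(4)[OF st] w(1)]])
    then show "C.\<delta> (H' s (H' t x)) (H' (s * t) x) = 0"
      unfolding w(2) H'[OF st(2) w(1)] H'[OF st(1) tw] H'[OF S'(4)[OF st] w(1)] .
  qed (use S' in auto)
qed

section \<open>Contractions\<close>

lemma contractible_space_if_scaled_to_point:
  assumes h: "continuous_map (prod_topology (top_of_set {0..1::real}) X) X h"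
    and h1: "\<And>x. x \<in> topspace X \<Longrightarrow> h (1, x) = x" and h0: "\<And>x. x \<in> topspace X \<Longrightarrow> h (0, x) = a"
  shows "contractible_space X"
proof -
  have "homotopic_with (\<lambda>x. True) X X (\<lambda>x. a) id"
    by (subst homotopic_with) (use assms in auto)
  then show ?thesis unfolding contractible_space_def using homotopic_with_sym by blast
qed

text \<open>The contraction of the group is composed with each endomorphism. For continuity in the
  compact-open topology, suppose that \<open>h (t, \<phi> x) \<in> U\<close> for all \<open>x\<close> in a compact set \<open>C\<close>. Then
  \<open>h\<close> maps the compact set \<open>{t} \<times> \<phi> ` C\<close> into \<open>U\<close>, and by Wallace's theorem it maps a whole
  product neighbourhood \<open>I \<times> O'\<close> of it into \<open>U\<close>. The condition \<open>f ` C \<subseteq> O'\<close> describes a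
  subbasic neighbourhood of \<open>\<phi>\<close>.\<close>

lemma contractible_space_End:
  assumes K: "group K" and top: "topspace X = carrier K"
    and h: "continuous_map (prod_topology (top_of_set {0..1::real}) X) X h"
    and hom: "\<And>t. t \<in> {0..1} \<Longrightarrow> (\<lambda>x. h (t, x)) \<in> hom K K"
    and h1: "\<And>x. x \<in> topspace X \<Longrightarrow> h (1, x) = x"
    and h0: "\<And>x. x \<in> topspace X \<Longrightarrow> h (0, x) = \<one>\<^bsub>K\<^esub>"
  shows "contractible_space (End_topology K X)"
proof (rule contractible_space_if_scaled_to_point)
  let ?F = "\<lambda>(t, \<phi>). \<lambda>x\<in>carrier K. h (t, \<phi> x)"
  have F: "?F (t, \<phi>) \<in> cont_End K X" if t: "t \<in> {0..1}" and \<phi>: "\<phi> \<in> cont_End K X" for t \<phi>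
  proof -
    have \<phi>h: "\<phi> \<in> hom K K" and \<phi>c: "continuous_map X X \<phi>" using \<phi> by (auto simp: cont_End_def)
    have "(\<lambda>x. h (t, \<phi> x)) \<in> hom K K"
      using hom_compose[OF \<phi>h hom[OF t]] by (simp add: comp_def)
    then have "restrict (\<lambda>x. h (t, \<phi> x)) (carrier K) \<in> hom K K"
      by (auto simp: hom_def K group.is_monoid monoid.m_closed)
    moreover have "continuous_map X X (h \<circ> (\<lambda>x. (t, \<phi> x)))"
      using t \<phi>c by (intro continuous_map_compose[OF _ h] continuous_map_pairedI) auto
    then have "continuous_map X X (restrict (\<lambda>x. h (t, \<phi> x)) (carrier K))"
      by (rule continuous_map_eq) (simp add: top)
    ultimately show ?thesis by (simp add: cont_End_def)
  qed
  show "continuous_map (prod_topology (top_of_set {0..1}) (End_topology K X)) (End_topology K X) ?F"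
    (is "continuous_map ?PE _ _")
    unfolding End_topology_def[of K X]
  proof (rule continuous_on_generated_topo, fold End_topology_def)
    fix W assume "W \<in> {{f \<in> cont_End K X. f ` C \<subseteq> U} | C U. compactin X C \<and> openin X U}"
    then obtain C U where W: "W = {f \<in> cont_End K X. f ` C \<subseteq> U}"
      and C: "compactin X C" and U: "openin X U" by blast
    have CK: "C \<subseteq> carrier K" using compactin_subset_topspace[OF C] top by simp
    show "openin ?PE (?F -` W \<inter> topspace ?PE)"
    proof (subst openin_subopen, intro ballI)
      fix z assume z: "z \<in> ?F -` W \<inter> topspace ?PE"
      obtain t \<phi> where tz: "z = (t, \<phi>)" by (cases z)
      have t: "t \<in> {0..1}" and \<phi>: "\<phi> \<in> cont_End K X"
        using z by (auto simp: tz topspace_End_topology)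
      have hU: "h (t, \<phi> x) \<in> U" if "x \<in> C" for x
        using z that CK by (auto simp: tz W)
      define V where "V = {y \<in> topspace (prod_topology (top_of_set {0..1}) X). h y \<in> U}"
      have V: "openin (prod_topology (top_of_set {0..1}) X) V"
        unfolding V_def using h U by (rule openin_continuous_map_preimage)
      have \<phi>c: "continuous_map X X \<phi>" using \<phi> by (simp add: cont_End_def)
      have "compactin X (\<phi> ` C)" using C \<phi>c by (rule image_compactin)
      moreover have "{t} \<times> \<phi> ` C \<subseteq> V"
        using t hU CK continuous_map_image_subset_topspace[OF \<phi>c] top by (auto simp: V_def)
      moreover have "compactin (top_of_set {0..1}) {t}" using t by simp
      ultimately obtain I O' where I: "openin (top_of_set {0..1}) I" "t \<in> I"
        and O': "openin X O'" "\<phi> ` C \<subseteq> O'" and sub: "I \<times> O' \<subseteq> V"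
        using Wallace_theorem_prod_topology[OF _ _ V] by (metis insert_subset)
      let ?N = "I \<times> {f \<in> cont_End K X. f ` C \<subseteq> O'}"
      have "openin (End_topology K X) {f \<in> cont_End K X. f ` C \<subseteq> O'}"
        unfolding End_topology_def using C O'(1) by (intro topology_generated_by_Basis) blast
      then have "openin ?PE ?N" using I(1) by (simp add: openin_prod_Times_iff)
      moreover have "z \<in> ?N" using I(2) O'(2) \<phi> by (simp add: tz)
      moreover have "?N \<subseteq> ?F -` W \<inter> topspace ?PE"
      proof
        fix y assume "y \<in> ?N"
        then obtain s f where y: "y = (s, f)" "s \<in> I" "f \<in> cont_End K X" "f ` C \<subseteq> O'" by blast
        have s: "s \<in> {0..1}" using openin_subset[OF I(1)] y(2) by auto
        have "h (s, f x) \<in> U" if "x \<in> C" for x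
          using sub y(2,4) that by (auto simp: V_def)
        then have "?F y \<in> W" using F[OF s y(3)] CK by (auto simp: y(1) W)
        then show "y \<in> ?F -` W \<inter> topspace ?PE"
          using s y by (simp add: topspace_End_topology)
      qed
      ultimately show "\<exists>N. openin ?PE N \<and> z \<in> N \<and> N \<subseteq> ?F -` W \<inter> topspace ?PE" by blast
    qed
  next
    have "?F ` topspace ?PE \<subseteq> cont_End K X"
      using F by (auto simp: topspace_End_topology)
    then show "?F ` topspace ?PE \<subseteq> \<Union> {{f \<in> cont_End K X. f ` C \<subseteq> U} | C U. compactin X C \<and> openin X U}"
      using topspace_End_topology[of K X] unfolding End_topology_def topology_generated_by_topspace
      by simp
  qed
  show "?F (1, \<phi>) = \<phi>" if "\<phi> \<in> topspace (End_topology K X)" for \<phi>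
  proof -
    have \<phi>: "\<phi> \<in> hom K K" "\<phi> \<in> extensional (carrier K)"
      using that by (auto simp: topspace_End_topology cont_End_def)
    have "h (1, \<phi> x) = \<phi> x" if "x \<in> carrier K" for x
      using h1 hom_in_carrier[OF \<phi>(1) that] top by simp
    then show ?thesis using \<phi>(2) by (auto intro: extensionalityI)
  qed
  show "?F (0, \<phi>) = (\<lambda>x\<in>carrier K. \<one>\<^bsub>K\<^esub>)" if "\<phi> \<in> topspace (End_topology K X)" for \<phi>
  proof -
    have "\<phi> \<in> hom K K" using that by (auto simp: topspace_End_topology cont_End_def)
    then have "h (0, \<phi> x) = \<one>\<^bsub>K\<^esub>" if "x \<in> carrier K" for x
      using h0 hom_in_carrier[OF _ that] top by metis
    then show ?thesis by (auto simp: restrict_def)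
  qed
qed

section \<open>The pseudonorm on the free product\<close>

locale weighted_letters =
  fixes G :: "('a, 'b) monoid_scheme" and N :: "'a \<Rightarrow> real"
  assumes weight_nonneg: "g \<in> carrier G \<Longrightarrow> 0 \<le> N g"
begin

sublocale F: group "FR G" by (rule group_FR)

abbreviation "\<psi> \<equiv> fr_scale G"

lemma gen_zero: "fr_gen g 0 = \<one>\<^bsub>FR G\<^esub>"
  by (simp add: fr_gen_def FR_def)

lemma gen_inv: "g \<in> carrier G \<Longrightarrow> inv\<^bsub>FR G\<^esub> (fr_gen g r) = fr_gen g (- r)"
  by (rule F.inv_equality) (simp_all add: fr_gen_add fr_gen_closed gen_zero)

lemma gen_nat_pow: "fr_gen g r [^]\<^bsub>FR G\<^esub> (n :: nat) = fr_gen g (real n * r)"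
  by (induction n) (simp_all add: gen_zero fr_gen_add algebra_simps)

lemma gen_int_pow: "g \<in> carrier G \<Longrightarrow> fr_gen g r [^]\<^bsub>FR G\<^esub> (k :: int) = fr_gen g (of_int k * r)"
  by (cases k) (simp_all add: int_pow_def2 gen_nat_pow gen_inv algebra_simps)

text \<open>The possible costs of factorizations into conjugates of letters. The exponents \<open>\<plusminus>1\<close> in the
  definition of \<open>fr_norm\<close> are absorbed into the sign of \<open>r\<close>, and the inductive form
  makes the behaviour under products, inverses, conjugation and scaling accessible to rule induction.\<close>

inductive cost :: "('a \<times> real) list \<Rightarrow> real \<Rightarrow> bool" where
  one: "cost \<one>\<^bsub>FR G\<^esub> 0"
| step: "h \<in> carrier (FR G) \<Longrightarrow> g \<in> carrier G \<Longrightarrow> cost y c \<Longrightarrow>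
    cost ((h \<otimes>\<^bsub>FR G\<^esub> fr_gen g r \<otimes>\<^bsub>FR G\<^esub> inv\<^bsub>FR G\<^esub> h) \<otimes>\<^bsub>FR G\<^esub> y) (\<bar>r\<bar> * N g + c)"

lemma cost_closed: "cost x c \<Longrightarrow> x \<in> carrier (FR G)"
  by (induction rule: cost.induct) (auto simp: fr_gen_closed)

lemma cost_nonneg: "cost x c \<Longrightarrow> 0 \<le> c"
  by (induction rule: cost.induct) (auto simp: weight_nonneg)

lemma cost_conj_gen:
  assumes "h \<in> carrier (FR G)" "g \<in> carrier G"
  shows "cost (h \<otimes>\<^bsub>FR G\<^esub> fr_gen g r \<otimes>\<^bsub>FR G\<^esub> inv\<^bsub>FR G\<^esub> h) (\<bar>r\<bar> * N g)"
  using cost.step[OF assms cost.one, of r] assms by (simp add: fr_gen_closed)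

lemma cost_gen: "g \<in> carrier G \<Longrightarrow> cost (fr_gen g r) (\<bar>r\<bar> * N g)"
  using cost_conj_gen[of "\<one>\<^bsub>FR G\<^esub>" g r] by (simp add: fr_gen_closed)

lemma cost_mult: "cost x c \<Longrightarrow> cost y d \<Longrightarrow> cost (x \<otimes>\<^bsub>FR G\<^esub> y) (c + d)"
proof (induction rule: cost.induct)
  case (step h g x c r)
  then show ?case
    using cost.step[OF step.hyps(1,2) step.IH[OF step.prems], of r]
    by (simp add: F.m_assoc fr_gen_closed cost_closed add.assoc)
qed (simp add: cost_closed)

lemma cost_inv: "cost x c \<Longrightarrow> cost (inv\<^bsub>FR G\<^esub> x) c"
proof (induction rule: cost.induct)
  case (step h g x c r)
  then show ?case
    using cost_mult[OF step.IH cost_conj_gen[OF step.hyps(1,2), of "- r"]]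
    by (simp add: F.inv_mult_group F.m_assoc fr_gen_closed cost_closed gen_inv add.commute)
qed (simp add: cost.one)

text \<open>Since conjugation by \<open>k\<close> is an automorphism, conjugating a product of conjugates
  conjugates each factor, at the same cost.\<close>

lemma cost_conj:
  "cost x c \<Longrightarrow> k \<in> carrier (FR G) \<Longrightarrow> cost (k \<otimes>\<^bsub>FR G\<^esub> x \<otimes>\<^bsub>FR G\<^esub> inv\<^bsub>FR G\<^esub> k) c"
proof (induction rule: cost.induct)
  case (step h g x c r)
  have "inv\<^bsub>FR G\<^esub> k \<otimes>\<^bsub>FR G\<^esub> (k \<otimes>\<^bsub>FR G\<^esub> z) = z" if "z \<in> carrier (FR G)" for z
    using that step.prems by (simp flip: F.m_assoc)
  then show ?case
    using cost.step[OF F.m_closed[OF step.prems step.hyps(1)] step.hyps(2) step.IH[OF step.prems], of r]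
      step.prems step.hyps
    by (simp add: F.inv_mult_group F.m_assoc fr_gen_closed cost_closed)
qed (simp add: cost.one)

lemma scale_hom: "group_hom (FR G) (FR G) (\<psi> t)"
  by unfold_locales (rule fr_scale_hom)

lemmas scale_closed = group_hom.hom_closed[OF scale_hom]
lemmas scale_mult = group_hom.hom_mult[OF scale_hom]
lemmas scale_inv = group_hom.hom_inv[OF scale_hom]

lemma cost_scale: "cost x c \<Longrightarrow> cost (\<psi> t x) (\<bar>t\<bar> * c)"
proof (induction rule: cost.induct)
  case one
  then show ?case using cost.one group_hom.hom_one[OF scale_hom] by simp
next
  case (step h g x c r)
  then show ?case
    using cost.step[OF scale_closed[OF step.hyps(1)] step.hyps(2) step.IH, of t "t * r"]
    by (simp add: scale_mult scale_inv fr_gen_closed cost_closed fr_scale_hom(2)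
        abs_mult algebra_simps)
qed

lemma letter_mult: "fr_cons (g, r) w = fr_gen g r \<otimes>\<^bsub>FR G\<^esub> w"
  by (simp add: FR_def fr_gen_def)

lemma eval_Cons: "fr_eval H \<phi> ((g, r) # w) = \<phi> g r \<otimes>\<^bsub>H\<^esub> fr_eval H \<phi> w"
  by (simp add: fr_eval_def)

lemma eval_gen: "x \<in> carrier (FR G) \<Longrightarrow> fr_eval (FR G) fr_gen x = x"
proof -
  have "fr_eval (FR G) fr_gen w = foldr fr_cons w []" for w :: "('a \<times> real) list"
    by (induction w) (auto simp: eval_Cons letter_mult, simp add: fr_eval_def FR_def)
  then show "x \<in> carrier (FR G) \<Longrightarrow> fr_eval (FR G) fr_gen x = x" by (simp add: fr_mult_one)
qed

lemma cost_exists: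
  assumes "x \<in> carrier (FR G)"
  shows "\<exists>c. cost x c"
proof -
  have "\<exists>c. cost (fr_eval (FR G) fr_gen w) c" if "set w \<subseteq> carrier G \<times> UNIV" for w
    using that
  proof (induction w)
    case Nil
    then show ?case using cost.one by (auto simp: fr_eval_def)
  next
    case (Cons a w)
    then show ?case using cost_mult[OF cost_gen] by (cases a) (force simp: eval_Cons)
  qed
  then show ?thesis using FR_letters[OF assms] eval_gen[OF assms] by metis
qed

lemma fr_norm_eq: "fr_norm G N x = Inf {c. cost x c}"
proof -
  let ?term = "\<lambda>(h, g, r :: real, e :: int). h \<otimes>\<^bsub>FR G\<^esub> (fr_gen g r [^]\<^bsub>FR G\<^esub> e) \<otimes>\<^bsub>FR G\<^esub> inv\<^bsub>FR G\<^esub> h"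
  let ?val = "\<lambda>ps. foldr (\<lambda>(h, g, r, e) y. ?term (h, g, r, e) \<otimes>\<^bsub>FR G\<^esub> y) ps \<one>\<^bsub>FR G\<^esub>"
  let ?sum = "\<lambda>ps. \<Sum>(h, g, r, e)\<leftarrow>ps. \<bar>r :: real\<bar> * N g"
  let ?ok = "\<lambda>ps. set ps \<subseteq> carrier (FR G) \<times> carrier G \<times> (UNIV :: real set) \<times> {1, -1 :: int}"
  have "cost (?val ps) (?sum ps)" if "?ok ps" for ps
    using that
  proof (induction ps)
    case Nil
    then show ?case by (simp add: cost.one)
  next
    case (Cons a ps)
    obtain h g r e where a: "a = (h, g, r, e)" by (cases a)
    have "cost ((h \<otimes>\<^bsub>FR G\<^esub> fr_gen g (of_int e * r) \<otimes>\<^bsub>FR G\<^esub> inv\<^bsub>FR G\<^esub> h) \<otimes>\<^bsub>FR G\<^esub> ?val ps)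
        (\<bar>of_int e * r\<bar> * N g + ?sum ps)"
      by (rule cost.step) (use Cons a in auto)
    then show ?case using Cons.prems a by (auto simp: gen_int_pow)
  qed
  moreover have "\<exists>ps. ?ok ps \<and> x = ?val ps \<and> c = ?sum ps" if "cost x c" for c
    using that
  proof (induction rule: cost.induct)
    case one
    then show ?case by (intro exI[of _ "[]"]) simp
  next
    case (step h g y c r)
    then obtain ps where "?ok ps" "y = ?val ps" "c = ?sum ps" by blast
    then show ?case using step.hyps
      by (intro exI[of _ "(h, g, r, 1) # ps"]) (simp add: gen_int_pow)
  qed
  ultimately have "{?sum ps | ps. ?ok ps \<and> x = ?val ps} = {c. cost x c}" by blast
  then show ?thesis unfolding fr_norm_def by simp
qed

lemma fr_norm_le: "cost x c \<Longrightarrow> fr_norm G N x \<le> c"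
  unfolding fr_norm_eq by (rule cInf_lower) (auto intro: bdd_belowI cost_nonneg)

lemma fr_norm_nonneg: "x \<in> carrier (FR G) \<Longrightarrow> 0 \<le> fr_norm G N x"
  unfolding fr_norm_eq using cost_exists by (intro cInf_greatest) (auto intro: cost_nonneg)

lemma fr_norm_cost:
  assumes "x \<in> carrier (FR G)" "0 < \<epsilon>"
  shows "\<exists>c. cost x c \<and> c < fr_norm G N x + \<epsilon>"
  using cInf_lessD[of "{c. cost x c}" "fr_norm G N x + \<epsilon>"] cost_exists[OF assms(1)] assms(2)
  by (auto simp: fr_norm_eq)

text \<open>The case \<open>a = 1\<close> transfers the closure properties of costs to the norm; the case
  \<open>a = \<bar>t\<bar>\<close> is used for the scaling \<open>\<psi> t\<close>.\<close>

lemma fr_norm_le_by_cost: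
  assumes x: "x \<in> carrier (FR G)" and a: "0 \<le> a" and c: "\<And>c. cost x c \<Longrightarrow> cost y (a * c)"
  shows "fr_norm G N y \<le> a * fr_norm G N x"
proof (rule field_le_epsilon)
  fix \<epsilon> :: real assume \<epsilon>: "0 < \<epsilon>"
  define \<eta> where "\<eta> = \<epsilon> / (a + 1)"
  have "0 < \<eta>" using \<epsilon> a by (simp add: \<eta>_def)
  then obtain c' where c': "cost x c'" "c' < fr_norm G N x + \<eta>" using fr_norm_cost[OF x] by blast
  have "fr_norm G N y \<le> a * c'" by (rule fr_norm_le[OF c[OF c'(1)]])
  also have "\<dots> \<le> a * (fr_norm G N x + \<eta>)" using c'(2) a by (intro mult_left_mono) auto
  also have "\<dots> \<le> a * fr_norm G N x + \<epsilon>" using a \<epsilon> by (simp add: \<eta>_def field_simps)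
  finally show "fr_norm G N y \<le> a * fr_norm G N x + \<epsilon>" .
qed

sublocale P: pseudonormed_group "FR G" "fr_norm G N"
proof
  show "0 \<le> fr_norm G N x" if "x \<in> carrier (FR G)" for x by (rule fr_norm_nonneg[OF that])
  show "fr_norm G N \<one>\<^bsub>FR G\<^esub> = 0"
    using fr_norm_le[OF cost.one] fr_norm_nonneg[of "\<one>\<^bsub>FR G\<^esub>"] by simp
  show "fr_norm G N (inv\<^bsub>FR G\<^esub> x) \<le> fr_norm G N x" if "x \<in> carrier (FR G)" for x
    using fr_norm_le_by_cost[OF that, of 1 "inv\<^bsub>FR G\<^esub> x"] cost_inv[of x] by simp
  show "fr_norm G N (h \<otimes>\<^bsub>FR G\<^esub> x \<otimes>\<^bsub>FR G\<^esub> inv\<^bsub>FR G\<^esub> h) \<le> fr_norm G N x"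
    if "x \<in> carrier (FR G)" "h \<in> carrier (FR G)" for x h
    using fr_norm_le_by_cost[OF that(1), of 1] cost_conj[OF _ that(2), of x] by simp
  show "fr_norm G N (x \<otimes>\<^bsub>FR G\<^esub> y) \<le> fr_norm G N x + fr_norm G N y"
    if x: "x \<in> carrier (FR G)" and y: "y \<in> carrier (FR G)" for x y
  proof (rule field_le_epsilon)
    fix \<epsilon> :: real assume "0 < \<epsilon>"
    then have "0 < \<epsilon> / 2" by simp
    then obtain c d where "cost x c" "c < fr_norm G N x + \<epsilon> / 2" "cost y d" "d < fr_norm G N y + \<epsilon> / 2"
      using fr_norm_cost[OF x] fr_norm_cost[OF y] by metis
    then show "fr_norm G N (x \<otimes>\<^bsub>FR G\<^esub> y) \<le> fr_norm G N x + fr_norm G N y + \<epsilon>"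
      using fr_norm_le[OF cost_mult[of x c y d]] by simp
  qed
qed

lemma norm_scale: "x \<in> carrier (FR G) \<Longrightarrow> fr_norm G N (\<psi> t x) \<le> \<bar>t\<bar> * fr_norm G N x"
  by (rule fr_norm_le_by_cost[OF _ _ cost_scale]) auto

lemma delta_scale:
  "x \<in> carrier (FR G) \<Longrightarrow> y \<in> carrier (FR G) \<Longrightarrow> P.\<delta> (\<psi> t x) (\<psi> t y) \<le> \<bar>t\<bar> * P.\<delta> x y"
  by (rule P.hom_contracts_delta[OF P.pseudonormed_group_axioms fr_scale_hom(1) norm_scale])

lemma delta_gen: "g \<in> carrier G \<Longrightarrow> P.\<delta> (fr_gen g r) (fr_gen g s) \<le> \<bar>r - s\<bar> * N g"
  using fr_norm_le[OF cost_gen[of g "s - r"]]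
  by (simp add: P.delta_eq fr_gen_closed gen_inv fr_gen_add algebra_simps abs_minus_commute)

text \<open>Changing the exponents of a fixed word letter by letter changes the product by at most the
  weighted sum of the changes, by bi-invariance. This controls both the dependence of \<open>\<psi> t\<close> on \<open>t\<close>
  and the rounding of exponents to integers.\<close>

lemma delta_eval:
  assumes "set w \<subseteq> carrier G \<times> UNIV"
  shows "P.\<delta> (fr_eval (FR G) (\<lambda>g r. fr_gen g (a r)) w) (fr_eval (FR G) (\<lambda>g r. fr_gen g (b r)) w)
    \<le> (\<Sum>(g, r)\<leftarrow>w. \<bar>a r - b r\<bar> * N g)"
  using assms
proof (induction w)
  case Nil
  then show ?case by (simp add: fr_eval_def)
next
  case (Cons x w)
  obtain g r where x: "x = (g, r)" by (cases x)
  have g: "g \<in> carrier G" and w: "set w \<subseteq> carrier G \<times> UNIV" using Cons.prems x by auto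
  have cl: "fr_eval (FR G) (\<lambda>g r. fr_gen g (c r)) w \<in> carrier (FR G)" for c
    by (rule fr_eval_closed[OF group_FR fr_gen_closed w])
  show ?case
    using P.delta_mult[OF fr_gen_closed[OF g] cl fr_gen_closed[OF g] cl, of "a r" a "b r" b]
      delta_gen[OF g, of "a r" "b r"] Cons.IH[OF w]
    by (simp add: x eval_Cons)
qed

text \<open>The weighted length of a word: a Lipschitz constant for the orbit \<open>t \<mapsto> \<psi> t w\<close>. It is not
  bounded in terms of the norm of \<open>w\<close>, which is why the limits below are reduced to estimates at
  a single fixed word.\<close>

definition len :: "('a \<times> real) list \<Rightarrow> real" where
  "len w = (\<Sum>(g, r)\<leftarrow>w. \<bar>r\<bar> * N g)"

lemma delta_scale_param:
  assumes "x \<in> carrier (FR G)"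
  shows "P.\<delta> (\<psi> s x) (\<psi> t x) \<le> \<bar>s - t\<bar> * len x"
proof -
  have "(\<Sum>(g, r)\<leftarrow>x. \<bar>s * r - t * r\<bar> * N g) = \<bar>s - t\<bar> * len x"
    by (simp add: len_def case_prod_unfold flip: sum_list_const_mult)
      (simp add: abs_mult mult.assoc flip: left_diff_distrib)
  then show ?thesis
    using delta_eval[OF FR_letters[OF assms], of "\<lambda>r. s * r" "\<lambda>r. t * r"]
    by (simp add: fr_scale_def)
qed

lemma hom_eval:
  assumes f: "f \<in> hom (FR G) (FR G)" and \<phi>: "\<And>g r. g \<in> carrier G \<Longrightarrow> \<phi> g r \<in> carrier (FR G)"
    and w: "set w \<subseteq> carrier G \<times> UNIV"
  shows "f (fr_eval (FR G) \<phi> w) = fr_eval (FR G) (\<lambda>g r. f (\<phi> g r)) w"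
  using w
proof (induction w)
  case Nil
  then show ?case using hom_one[OF f group_FR group_FR] by (simp add: fr_eval_def)
next
  case (Cons a w)
  obtain g r where a: "a = (g, r)" by (cases a)
  have "fr_eval (FR G) \<phi> w \<in> carrier (FR G)"
    using Cons.prems by (intro fr_eval_closed[OF group_FR \<phi>]) auto
  then show ?case using Cons hom_mult[OF f] \<phi> by (simp add: a eval_Cons)
qed

lemma eval_cong:
  assumes "set w \<subseteq> carrier G \<times> UNIV" "\<And>g r. g \<in> carrier G \<Longrightarrow> \<phi> g r = \<phi>' g r"
  shows "fr_eval H \<phi> w = fr_eval H \<phi>' w"
  using assms(1) by (induction w) (auto simp: eval_Cons assms(2), simp add: fr_eval_def)

lemma scale_eval:
  assumes w: "set w \<subseteq> carrier G \<times> UNIV"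
  shows "\<psi> t (fr_eval (FR G) (\<lambda>g r. fr_gen g (a r)) w) = fr_eval (FR G) (\<lambda>g r. fr_gen g (t * a r)) w"
  by (subst hom_eval[OF fr_scale_hom(1) fr_gen_closed w]) (auto intro: eval_cong[OF w] fr_scale_hom(2))

lemma scale_scale:
  assumes "x \<in> carrier (FR G)"
  shows "\<psi> s (\<psi> t x) = \<psi> (s * t) x"
  using scale_eval[OF FR_letters[OF assms], of s "\<lambda>r. t * r"]
  by (simp add: fr_scale_def mult.assoc)

lemma scale_one: "x \<in> carrier (FR G) \<Longrightarrow> \<psi> 1 x = x"
  using eval_gen by (simp add: fr_scale_def)

end

section \<open>Limits along a scaling set\<close>

lemma eventually_at_top_in:
  "eventually Q (at_top_in T) \<longleftrightarrow> (\<exists>t0. \<forall>t\<in>T. t0 \<le> t \<longrightarrow> Q t)"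
  unfolding at_top_in_def eventually_inf_principal eventually_at_top_linorder by blast

lemma eventually_in_scaling: "\<forall>\<^sub>F t in at_top_in T. t \<in> T"
  by (auto simp: eventually_at_top_in)

lemma cauchy_in_eventually:
  assumes "cauchy_in d T f" "0 < \<epsilon>"
  shows "\<exists>t0. \<forall>t\<in>T. t0 \<le> t \<longrightarrow> (\<forall>t'\<in>T. t0 \<le> t' \<longrightarrow> d (f t) (f t') < \<epsilon>)"
  using assms unfolding cauchy_in_def by blast

lemma scaling_set_cofinal:
  assumes "scaling_set T"
  shows "\<exists>t\<in>T. t0 \<le> t"
proof (rule ccontr)
  assume "\<not> ?thesis"
  then have "T \<subseteq> {0..t0}" using assms by (force simp: scaling_set_def)
  then show False using assms bounded_subset[of "{0..t0}" T] by (auto simp: scaling_set_def)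
qed

lemma at_top_in_neq_bot: "scaling_set T \<Longrightarrow> at_top_in T \<noteq> bot"
  using scaling_set_cofinal[of T] by (force simp: trivial_limit_def eventually_at_top_in)

lemma filterlim_at_top_in:
  assumes "scaling_set T"
  shows "filterlim (\<lambda>t. t) at_top (at_top_in T)"
  unfolding at_top_in_def by (rule filterlim_mono[OF filterlim_ident]) auto

text \<open>Completeness of the reals for Cauchy families indexed by a scaling set, so that \<open>DD_norm\<close> is an
  actual limit.\<close>

lemma cauchy_in_real_converges:
  fixes f :: "real \<Rightarrow> real"
  assumes T: "scaling_set T" and f: "cauchy_in (\<lambda>x y. \<bar>x - y\<bar>) T f"
  shows "(f \<longlongrightarrow> Lim (at_top_in T) f) (at_top_in T)"
proof -
  have "cauchy_filter (filtermap f (at_top_in T))"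
    unfolding cauchy_filter_metric_filtermap
  proof (intro allI impI)
    fix \<epsilon> :: real assume "0 < \<epsilon>"
    then obtain t0 where "\<forall>t\<in>T. t0 \<le> t \<longrightarrow> (\<forall>t'\<in>T. t0 \<le> t' \<longrightarrow> \<bar>f t - f t'\<bar> < \<epsilon>)"
      using cauchy_in_eventually[OF f] by metis
    then show "\<exists>Q. eventually Q (at_top_in T) \<and> (\<forall>x y. Q x \<and> Q y \<longrightarrow> dist (f x) (f y) < \<epsilon>)"
      by (intro exI[of _ "\<lambda>t. t \<in> T \<and> t0 \<le> t"]) (auto simp: eventually_at_top_in dist_real_def)
  qed
  then have "\<exists>l. filtermap f (at_top_in T) \<le> nhds l"
    by (rule cauchy_filter_complete_converges[OF _ complete_UNIV])
      (simp_all add: filtermap_bot_iff at_top_in_neq_bot[OF T])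
  then obtain l where "(f \<longlongrightarrow> l) (at_top_in T)" by (auto simp: filterlim_def)
  moreover from this have "Lim (at_top_in T) f = l"
    by (rule tendsto_Lim[OF at_top_in_neq_bot[OF T]])
  ultimately show ?thesis by simp
qed

text \<open>In \<open>\<sigma> t = (\<sigma> t / t) * t\<close> the first factor has a positive limit.\<close>

lemma ample_reparametrization:
  assumes T: "scaling_set T" and lim: "((\<lambda>t. \<sigma> t / t) \<longlongrightarrow> s) (at_top_in T)" and s: "0 < s"
  shows "filterlim \<sigma> at_top (at_top_in T)"
proof -
  have "filterlim (\<lambda>t. \<sigma> t / t * t) at_top (at_top_in T)"
    by (rule filterlim_tendsto_pos_mult_at_top[OF lim s filterlim_at_top_in[OF T]])
  moreover have "\<forall>\<^sub>F t in at_top_in T. \<sigma> t / t * t = \<sigma> t"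
    using eventually_in_scaling[of T]
  proof eventually_elim
    case (elim t)
    then have "0 < t" using T by (auto simp: scaling_set_def)
    then show ?case by simp
  qed
  ultimately show ?thesis by (simp cong: filterlim_cong)
qed

section \<open>Cauchy families in the free product\<close>

locale directional_cone = weighted_letters G N for G :: "('a, 'b) monoid_scheme" and N +
  fixes T :: "real set"
  assumes group_G: "group G" and scaling: "scaling_set T"
begin

abbreviation "E \<equiv> at_top_in T"

lemma T_pos: "t \<in> T \<Longrightarrow> 0 < t"
  using scaling by (auto simp: scaling_set_def)

abbreviation approx :: "(real \<Rightarrow> ('a \<times> real) list) \<Rightarrow> (real \<Rightarrow> ('a \<times> real) list) \<Rightarrow> bool"
    (infix "\<simeq>" 50) where
  "f \<simeq> g \<equiv> ((\<lambda>t. P.\<delta> (f t) (g t)) \<longlongrightarrow> 0) E"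

abbreviation cauchy :: "(real \<Rightarrow> ('a \<times> real) list) \<Rightarrow> bool" where
  "cauchy \<equiv> cauchy_in P.\<delta> T"

lemma approxI:
  assumes "(g \<longlongrightarrow> 0) E" "\<And>t. t \<in> T \<Longrightarrow> P.\<delta> (f t) (f' t) \<le> g t"
  shows "f \<simeq> f'"
proof (rule tendsto_sandwich[OF _ _ tendsto_const assms(1)])
  show "\<forall>\<^sub>F t in E. P.\<delta> (f t) (f' t) \<le> g t"
    using eventually_in_scaling by eventually_elim (rule assms(2))
qed (simp add: P.delta_nonneg)

lemma approx_sym: "f \<simeq> g \<Longrightarrow> g \<simeq> f"
  by (simp add: P.delta_sym)

lemma approx_scale:
  assumes "f \<simeq> g" "f \<in> T \<rightarrow> carrier (FR G)" "g \<in> T \<rightarrow> carrier (FR G)"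
  shows "(\<lambda>t. \<psi> s (f t)) \<simeq> (\<lambda>t. \<psi> s (g t))"
proof (rule approxI)
  show "((\<lambda>t. \<bar>s\<bar> * P.\<delta> (f t) (g t)) \<longlongrightarrow> 0) E"
    using tendsto_mult_left[OF assms(1), of "\<bar>s\<bar>"] by simp
qed (use assms in \<open>auto intro: delta_scale\<close>)

text \<open>A Cauchy family is eventually close to one of its own values. This replaces its limit,
  which need not exist in the free product.\<close>

lemma cauchy_center:
  assumes f: "cauchy f" and \<epsilon>: "0 < \<epsilon>"
  obtains t0 where "t0 \<in> T" "\<And>t. t \<in> T \<Longrightarrow> t0 \<le> t \<Longrightarrow> P.\<delta> (f t0) (f t) < \<epsilon>"
proof -
  obtain t1 where t1: "\<forall>t\<in>T. t1 \<le> t \<longrightarrow> (\<forall>t'\<in>T. t1 \<le> t' \<longrightarrow> P.\<delta> (f t) (f t') < \<epsilon>)"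
    using cauchy_in_eventually[OF f \<epsilon>] by blast
  obtain t0 where "t0 \<in> T" "t1 \<le> t0" using scaling_set_cofinal[OF scaling] by blast
  then show ?thesis using t1 by (intro that[of t0]) auto
qed

lemma cauchyI:
  assumes f: "f \<in> T \<rightarrow> carrier (FR G)"
    and c: "\<And>\<epsilon>. 0 < \<epsilon> \<Longrightarrow> \<exists>x\<in>carrier (FR G). \<forall>\<^sub>F t in E. P.\<delta> x (f t) \<le> \<epsilon>"
  shows "cauchy f"
  unfolding cauchy_in_def
proof (intro allI impI)
  fix \<epsilon> :: real assume "0 < \<epsilon>"
  then have "0 < \<epsilon> / 3" by simp
  from c[OF this] obtain x t0 where x: "x \<in> carrier (FR G)"
    and t0: "\<And>t. t \<in> T \<Longrightarrow> t0 \<le> t \<Longrightarrow> P.\<delta> x (f t) \<le> \<epsilon> / 3"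
    unfolding eventually_at_top_in by blast
  have "P.\<delta> (f t) (f t') < \<epsilon>" if "t \<in> T" "t' \<in> T" "t0 \<le> t" "t0 \<le> t'" for t t'
    using P.delta_triangle[of "f t" x "f t'"] P.delta_sym[of "f t" x] t0[of t] t0[of t'] that f x
      \<open>0 < \<epsilon> / 3\<close> by (auto simp: Pi_iff)
  then show "\<exists>t0. \<forall>t\<in>T. \<forall>t'\<in>T. t0 \<le> t \<longrightarrow> t0 \<le> t' \<longrightarrow> P.\<delta> (f t) (f t') < \<epsilon>" by blast
qed

lemma cauchy_approx:
  assumes f: "cauchy f" and fg: "f \<simeq> g"
    and cl: "f \<in> T \<rightarrow> carrier (FR G)" "g \<in> T \<rightarrow> carrier (FR G)"
  shows "cauchy g"
proof (rule cauchyI[OF cl(2)])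
  fix \<epsilon> :: real assume "0 < \<epsilon>"
  then have \<epsilon>: "0 < \<epsilon> / 2" by simp
  obtain t0 where t0: "t0 \<in> T" "\<And>t. t \<in> T \<Longrightarrow> t0 \<le> t \<Longrightarrow> P.\<delta> (f t0) (f t) < \<epsilon> / 2"
    using cauchy_center[OF f \<epsilon>] by blast
  have "\<forall>\<^sub>F t in E. t0 \<le> t"
    by (auto simp: eventually_at_top_in)
  moreover have "\<forall>\<^sub>F t in E. P.\<delta> (f t) (g t) < \<epsilon> / 2"
    using order_tendstoD(2)[OF fg \<epsilon>] .
  ultimately have "\<forall>\<^sub>F t in E. P.\<delta> (f t0) (g t) \<le> \<epsilon>"
    using eventually_in_scaling[of T]
  proof eventually_elim
    case (elim t)
    then show ?case
      using P.delta_triangle[of "f t0" "f t" "g t"] t0 cl by (force simp: Pi_iff)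
  qed
  then show "\<exists>x\<in>carrier (FR G). \<forall>\<^sub>F t in E. P.\<delta> x (g t) \<le> \<epsilon>"
    using t0(1) cl(1) by blast
qed

lemma cauchy_const: "x \<in> carrier (FR G) \<Longrightarrow> cauchy (\<lambda>t. x)"
  by (auto simp: cauchy_in_def)

lemma cauchy_scale:
  assumes f: "cauchy f" and cl: "f \<in> T \<rightarrow> carrier (FR G)"
  shows "cauchy (\<lambda>t. \<psi> s (f t))"
proof (rule cauchyI)
  fix \<epsilon> :: real assume \<epsilon>: "0 < \<epsilon>"
  then have "0 < \<epsilon> / (\<bar>s\<bar> + 1)" by simp
  then obtain t0 where t0: "t0 \<in> T" "\<And>t. t \<in> T \<Longrightarrow> t0 \<le> t \<Longrightarrow> P.\<delta> (f t0) (f t) < \<epsilon> / (\<bar>s\<bar> + 1)"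
    using cauchy_center[OF f] by blast
  have "P.\<delta> (\<psi> s (f t0)) (\<psi> s (f t)) \<le> \<epsilon>" if t: "t \<in> T" "t0 \<le> t" for t
  proof -
    have "P.\<delta> (\<psi> s (f t0)) (\<psi> s (f t)) \<le> \<bar>s\<bar> * P.\<delta> (f t0) (f t)"
      using t t0(1) cl by (intro delta_scale) auto
    also have "\<dots> \<le> \<bar>s\<bar> * (\<epsilon> / (\<bar>s\<bar> + 1))"
      using t0(2)[OF t] by (intro mult_left_mono) auto
    also have "\<dots> \<le> \<epsilon>" using \<epsilon> by (simp add: field_simps)
    finally show ?thesis .
  qed
  then show "\<exists>x\<in>carrier (FR G). \<forall>\<^sub>F t in E. P.\<delta> x (\<psi> s (f t)) \<le> \<epsilon>"
    using t0(1) cl by (intro bexI[of _ "\<psi> s (f t0)"])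
      (auto simp: eventually_at_top_in intro: scale_closed)
qed (use cl in \<open>auto intro: scale_closed\<close>)

lemma cauchy_mult:
  assumes f: "cauchy f" "f \<in> T \<rightarrow> carrier (FR G)" and g: "cauchy g" "g \<in> T \<rightarrow> carrier (FR G)"
  shows "cauchy (\<lambda>t. f t \<otimes>\<^bsub>FR G\<^esub> g t)"
proof (rule cauchyI)
  fix \<epsilon> :: real assume "0 < \<epsilon>"
  then have \<epsilon>: "0 < \<epsilon> / 2" by simp
  obtain a where a: "a \<in> T" "\<And>t. t \<in> T \<Longrightarrow> a \<le> t \<Longrightarrow> P.\<delta> (f a) (f t) < \<epsilon> / 2"
    using cauchy_center[OF f(1) \<epsilon>] by blast
  obtain b where b: "b \<in> T" "\<And>t. t \<in> T \<Longrightarrow> b \<le> t \<Longrightarrow> P.\<delta> (g b) (g t) < \<epsilon> / 2"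
    using cauchy_center[OF g(1) \<epsilon>] by blast
  have "P.\<delta> (f a \<otimes>\<^bsub>FR G\<^esub> g b) (f t \<otimes>\<^bsub>FR G\<^esub> g t) \<le> \<epsilon>" if "t \<in> T" "max a b \<le> t" for t
  proof -
    have "P.\<delta> (f a) (f t) < \<epsilon> / 2" "P.\<delta> (g b) (g t) < \<epsilon> / 2" using a(2) b(2) that by auto
    moreover have "P.\<delta> (f a \<otimes>\<^bsub>FR G\<^esub> g b) (f t \<otimes>\<^bsub>FR G\<^esub> g t) \<le> P.\<delta> (f a) (f t) + P.\<delta> (g b) (g t)"
      using a(1) b(1) that(1) f(2) g(2) by (intro P.delta_mult) auto
    ultimately show ?thesis by simp
  qed
  then show "\<exists>x\<in>carrier (FR G). \<forall>\<^sub>F t in E. P.\<delta> x (f t \<otimes>\<^bsub>FR G\<^esub> g t) \<le> \<epsilon>"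
    using a(1) b(1) f(2) g(2)
    by (intro bexI[of _ "f a \<otimes>\<^bsub>FR G\<^esub> g b"]) (auto simp: eventually_at_top_in intro!: exI[of _ "max a b"])
qed (use f g in auto)

lemma cauchy_inv:
  assumes f: "cauchy f" "f \<in> T \<rightarrow> carrier (FR G)"
  shows "cauchy (\<lambda>t. inv\<^bsub>FR G\<^esub> f t)"
proof -
  have "P.\<delta> (inv\<^bsub>FR G\<^esub> f t) (inv\<^bsub>FR G\<^esub> f t') = P.\<delta> (f t) (f t')" if "t \<in> T" "t' \<in> T" for t t'
    using f(2) that by (intro P.delta_inv) auto
  then show ?thesis using f(1) unfolding cauchy_in_def by simp
qed

lemma cauchy_norm_tendsto:
  assumes f: "cauchy f" "f \<in> T \<rightarrow> carrier (FR G)"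
  shows "((\<lambda>t. fr_norm G N (f t)) \<longlongrightarrow> Lim E (\<lambda>t. fr_norm G N (f t))) E"
proof (rule cauchy_in_real_converges[OF scaling])
  have "\<bar>fr_norm G N (f t) - fr_norm G N (f t')\<bar> \<le> P.\<delta> (f t) (f t')" if "t \<in> T" "t' \<in> T" for t t'
    using f(2) that by (intro P.P_delta) auto
  then show "cauchy_in (\<lambda>x y. \<bar>x - y\<bar>) T (\<lambda>t. fr_norm G N (f t))"
    using f(1) unfolding cauchy_in_def by (meson order_le_less_trans)
qed

text \<open>The key estimate. Passing from \<open>f t\<close> to \<open>f (\<tau> t)\<close> does not matter because both are eventually
  close to one value \<open>x = f t0\<close>; the maps \<open>\<psi> (c t)\<close> are uniformly Lipschitz; and
  \<open>\<psi> (c t) x\<close> tends to \<open>\<psi> s x\<close> for the fixed word \<open>x\<close>.\<close>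

lemma reparametrized_approx:
  assumes f: "cauchy f" "f \<in> T \<rightarrow> carrier (FR G)" and c: "(c \<longlongrightarrow> s) E"
    and \<tau>: "\<tau> \<in> T \<rightarrow> T" "filterlim \<tau> at_top E"
  shows "(\<lambda>t. \<psi> (c t) (f (\<tau> t))) \<simeq> (\<lambda>t. \<psi> s (f t))"
proof (rule tendstoI)
  fix \<epsilon> :: real assume \<epsilon>: "0 < \<epsilon>"
  define a where "a = \<bar>s\<bar> + 1"
  have a: "0 < a" by (simp add: a_def)
  define \<eta> where "\<eta> = \<epsilon> / (4 * a)"
  have \<eta>: "0 < \<eta>" and a\<eta>: "a * \<eta> = \<epsilon> / 4"
    using \<epsilon> a by (simp_all add: \<eta>_def)
  obtain t0 where t0: "t0 \<in> T" "\<And>t. t \<in> T \<Longrightarrow> t0 \<le> t \<Longrightarrow> P.\<delta> (f t0) (f t) < \<eta>"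
    using cauchy_center[OF f(1) \<eta>] by blast
  have x: "f t0 \<in> carrier (FR G)" using t0(1) f(2) by blast
  have "((\<lambda>t. \<bar>c t - s\<bar> * len (f t0)) \<longlongrightarrow> \<bar>s - s\<bar> * len (f t0)) E"
    by (intro tendsto_intros c)
  then have "\<forall>\<^sub>F t in E. \<bar>c t - s\<bar> * len (f t0) < \<epsilon> / 2"
    using \<epsilon> by (intro order_tendstoD) auto
  moreover have "\<forall>\<^sub>F t in E. \<bar>c t - s\<bar> < 1"
    using tendstoD[OF c, of 1] by (simp add: dist_real_def)
  moreover have "\<forall>\<^sub>F t in E. t0 \<le> \<tau> t" using \<tau>(2) by (simp add: filterlim_at_top)
  moreover have "\<forall>\<^sub>F t in E. t0 \<le> t" by (auto simp: eventually_at_top_in)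
  ultimately show "\<forall>\<^sub>F t in E. dist (P.\<delta> (\<psi> (c t) (f (\<tau> t))) (\<psi> s (f t))) 0 < \<epsilon>"
    using eventually_in_scaling[of T]
  proof eventually_elim
    case (elim t)
    have ft: "f t \<in> carrier (FR G)" "f (\<tau> t) \<in> carrier (FR G)" using elim(5) \<tau>(1) f(2) by auto
    have "P.\<delta> (\<psi> (c t) (f (\<tau> t))) (\<psi> (c t) (f t0)) \<le> \<bar>c t\<bar> * P.\<delta> (f t0) (f (\<tau> t))"
      using delta_scale[OF ft(2) x] by (simp add: P.delta_sym)
    also have "\<dots> \<le> a * \<eta>"
      using t0(2)[OF funcset_mem[OF \<tau>(1) elim(5)] elim(3)] elim(2)
      by (intro mult_mono P.delta_nonneg) (auto simp: a_def)
    finally have 1: "P.\<delta> (\<psi> (c t) (f (\<tau> t))) (\<psi> (c t) (f t0)) \<le> a * \<eta>" .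
    have "P.\<delta> (\<psi> s (f t0)) (\<psi> s (f t)) \<le> \<bar>s\<bar> * P.\<delta> (f t0) (f t)"
      by (rule delta_scale[OF x ft(1)])
    also have "\<dots> \<le> a * \<eta>"
      using t0(2)[of t] elim a by (intro mult_mono P.delta_nonneg) (auto simp: less_imp_le a_def)
    finally have 2: "P.\<delta> (\<psi> s (f t0)) (\<psi> s (f t)) \<le> a * \<eta>" .
    have "P.\<delta> (\<psi> (c t) (f (\<tau> t))) (\<psi> s (f t))
        \<le> P.\<delta> (\<psi> (c t) (f (\<tau> t))) (\<psi> (c t) (f t0)) + P.\<delta> (\<psi> (c t) (f t0)) (\<psi> s (f t0))
          + P.\<delta> (\<psi> s (f t0)) (\<psi> s (f t))"
      using P.delta_triangle[OF scale_closed[OF ft(2)] scale_closed[OF x] scale_closed[OF ft(1)],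
          of "c t" s "c t"]
        P.delta_triangle[OF scale_closed[OF x] scale_closed[OF x] scale_closed[OF ft(1)],
          of "c t" s s] by simp
    also have "\<dots> \<le> \<epsilon> / 2 + \<bar>c t - s\<bar> * len (f t0)"
      using 1 2 delta_scale_param[OF x, of "c t" s] by (simp add: a\<eta>)
    also have "\<dots> < \<epsilon>"
      using elim(1) by simp
    finally show ?case using P.delta_nonneg by simp
  qed
qed

section \<open>The group of directions\<close>

abbreviation "\<D> \<equiv> DD G N T"
abbreviation "\<D>n \<equiv> DD_norm G N T"

text \<open>The rescaled family whose limit a direction \<open>w\<close> represents.\<close>

definition profile :: "(real \<Rightarrow> ('a \<times> real) list) \<Rightarrow> real \<Rightarrow> ('a \<times> real) list" where
  "profile w t = \<psi> (1 / t) (w t)"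

lemma FZ_subgroup: "subgroup (carrier (FZ G)) (FR G)"
  unfolding FZ_def by (rule F.subgroup_subgroup_generated)

lemma FZ_closed: "x \<in> carrier (FZ G) \<Longrightarrow> x \<in> carrier (FR G)"
  by (rule FZ_letters(1))

lemma FZ_group: "group (FZ G)"
  unfolding FZ_def by (rule F.group_subgroup_generated)

lemma FZ_mult: "x \<otimes>\<^bsub>FZ G\<^esub> y = x \<otimes>\<^bsub>FR G\<^esub> y"
  by (simp add: FZ_def)

lemma FZ_inv: "x \<in> carrier (FZ G) \<Longrightarrow> inv\<^bsub>FZ G\<^esub> x = inv\<^bsub>FR G\<^esub> x"
  unfolding FZ_def by (rule F.inv_subgroup_generated)

lemma FZ_one: "\<one>\<^bsub>FZ G\<^esub> = \<one>\<^bsub>FR G\<^esub>"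
  by (simp add: FZ_def)

lemma gen_in_FZ: "g \<in> carrier G \<Longrightarrow> r \<in> \<int> \<Longrightarrow> fr_gen g r \<in> carrier (FZ G)"
  using F.subgroup_int_pow_closed[OF FZ_subgroup, of "fr_gen g 1" "\<lfloor>r\<rfloor>"] fz_proj_hom(2)[OF group_G]
  by (auto simp: gen_int_pow elim!: Ints_cases)

text \<open>Integrality of all exponents suffices for membership in the subgroup generated by the letters
  with exponent 1. It is applied to roundings, where the exponents are floors, and to \<open>\<psi> k\<close>
  for an integer \<open>k\<close>.\<close>

lemma eval_in_FZ:
  assumes "\<And>g r. (g, r) \<in> set w \<Longrightarrow> g \<in> carrier G \<and> a r \<in> \<int>"
  shows "fr_eval (FR G) (\<lambda>g r. fr_gen g (a r)) w \<in> carrier (FZ G)"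
  using assms
proof (induction w)
  case Nil
  then show ?case using subgroup.one_closed[OF FZ_subgroup] by (simp add: fr_eval_def)
next
  case (Cons x w)
  obtain g r where x: "x = (g, r)" by (cases x)
  have "fr_gen g (a r) \<in> carrier (FZ G)" using Cons.prems x by (intro gen_in_FZ) auto
  moreover have "fr_eval (FR G) (\<lambda>g r. fr_gen g (a r)) w \<in> carrier (FZ G)"
    by (rule Cons.IH) (use Cons.prems in auto)
  ultimately show ?case using subgroup.m_closed[OF FZ_subgroup] by (simp add: x eval_Cons)
qed

lemma scale_in_FZ: "x \<in> carrier (FZ G) \<Longrightarrow> k \<in> \<int> \<Longrightarrow> \<psi> k x \<in> carrier (FZ G)"
  unfolding fr_scale_def using FZ_letters(2) by (intro eval_in_FZ) (auto intro!: Ints_mult)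

lemma DD_carrier: "carrier \<D> = {w \<in> \<Pi>\<^sub>E t\<in>T. carrier (FZ G). cauchy (profile w)}"
  by (auto simp: DD_def profile_def[abs_def])

lemma DD_in_FZ: "w \<in> carrier \<D> \<Longrightarrow> t \<in> T \<Longrightarrow> w t \<in> carrier (FZ G)"
  by (auto simp: DD_carrier)

lemma profile_closed: "w \<in> (\<Pi>\<^sub>E t\<in>T. carrier (FZ G)) \<Longrightarrow> profile w \<in> T \<rightarrow> carrier (FR G)"
  unfolding profile_def by (intro funcsetI scale_closed FZ_closed) auto

lemma DD_profile: "w \<in> carrier \<D> \<Longrightarrow> profile w \<in> T \<rightarrow> carrier (FR G)" "w \<in> carrier \<D> \<Longrightarrow> cauchy (profile w)"
  using profile_closed by (auto simp: DD_carrier)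

lemma group_product_FZ: "group (product_group T (\<lambda>_. FZ G))"
  by (simp add: FZ_group)

lemma PiE_FR: "w \<in> (\<Pi>\<^sub>E t\<in>T. carrier (FZ G)) \<Longrightarrow> t \<in> T \<Longrightarrow> w t \<in> carrier (FR G)"
  by (intro FZ_closed) auto

lemma product_FZ_inv:
  assumes "w \<in> (\<Pi>\<^sub>E t\<in>T. carrier (FZ G))" "t \<in> T"
  shows "(inv\<^bsub>product_group T (\<lambda>_. FZ G)\<^esub> w) t = inv\<^bsub>FR G\<^esub> (w t)"
  using FZ_inv[OF PiE_mem[OF assms]] assms by (simp add: FZ_group)

lemma profile_mult:
  "v \<in> (\<Pi>\<^sub>E t\<in>T. carrier (FZ G)) \<Longrightarrow> w \<in> (\<Pi>\<^sub>E t\<in>T. carrier (FZ G)) \<Longrightarrow> t \<in> T \<Longrightarrow>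
    profile (v \<otimes>\<^bsub>product_group T (\<lambda>_. FZ G)\<^esub> w) t = profile v t \<otimes>\<^bsub>FR G\<^esub> profile w t"
  using PiE_FR[of v t] PiE_FR[of w t] by (simp add: profile_def FZ_mult scale_mult)

lemma profile_inv:
  "w \<in> (\<Pi>\<^sub>E t\<in>T. carrier (FZ G)) \<Longrightarrow> t \<in> T \<Longrightarrow>
    profile (inv\<^bsub>product_group T (\<lambda>_. FZ G)\<^esub> w) t = inv\<^bsub>FR G\<^esub> (profile w t)"
  using PiE_FR[of w t] product_FZ_inv[of w t] by (simp add: profile_def scale_inv)

lemma cauchy_cong: "cauchy f \<Longrightarrow> (\<And>t. t \<in> T \<Longrightarrow> f t = g t) \<Longrightarrow> cauchy g"
  unfolding cauchy_in_def by simp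

lemma DD_subgroup: "subgroup (carrier \<D>) (product_group T (\<lambda>_. FZ G))"
proof -
  interpret PG: group "product_group T (\<lambda>_. FZ G)" by (rule group_product_FZ)
  have sub: "w \<in> (\<Pi>\<^sub>E t\<in>T. carrier (FZ G))" if "w \<in> carrier \<D>" for w
    using that by (simp add: DD_carrier)
  show ?thesis
  proof
    show "carrier \<D> \<subseteq> carrier (product_group T (\<lambda>_. FZ G))" using sub by auto
    show "v \<otimes>\<^bsub>product_group T (\<lambda>_. FZ G)\<^esub> w \<in> carrier \<D>"
      if v: "v \<in> carrier \<D>" and w: "w \<in> carrier \<D>" for v w
    proof -
      have "cauchy (\<lambda>t. profile v t \<otimes>\<^bsub>FR G\<^esub> profile w t)"
        by (rule cauchy_mult) (use DD_profile v w in auto)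
      then have "cauchy (profile (v \<otimes>\<^bsub>product_group T (\<lambda>_. FZ G)\<^esub> w))"
        by (rule cauchy_cong) (rule profile_mult[OF sub[OF v] sub[OF w], symmetric])
      moreover have "v \<otimes>\<^bsub>product_group T (\<lambda>_. FZ G)\<^esub> w \<in> (\<Pi>\<^sub>E t\<in>T. carrier (FZ G))"
        using PG.m_closed[of v w] sub[OF v] sub[OF w] unfolding carrier_product_group by blast
      ultimately show ?thesis unfolding DD_carrier by blast
    qed
    show "\<one>\<^bsub>product_group T (\<lambda>_. FZ G)\<^esub> \<in> carrier \<D>"
    proof -
      have "cauchy (profile \<one>\<^bsub>product_group T (\<lambda>_. FZ G)\<^esub>)"
        by (rule cauchy_cong[OF cauchy_const[OF F.one_closed]])
          (simp add: profile_def FZ_one group_hom.hom_one[OF scale_hom])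
      moreover have "\<one>\<^bsub>product_group T (\<lambda>_. FZ G)\<^esub> \<in> (\<Pi>\<^sub>E t\<in>T. carrier (FZ G))"
        using PG.one_closed unfolding carrier_product_group .
      ultimately show ?thesis unfolding DD_carrier by blast
    qed
    show "inv\<^bsub>product_group T (\<lambda>_. FZ G)\<^esub> w \<in> carrier \<D>" if w: "w \<in> carrier \<D>" for w
    proof -
      have "cauchy (\<lambda>t. inv\<^bsub>FR G\<^esub> (profile w t))"
        by (rule cauchy_inv) (use DD_profile w in auto)
      then have "cauchy (profile (inv\<^bsub>product_group T (\<lambda>_. FZ G)\<^esub> w))"
        by (rule cauchy_cong) (rule profile_inv[OF sub[OF w], symmetric])
      moreover have "inv\<^bsub>product_group T (\<lambda>_. FZ G)\<^esub> w \<in> (\<Pi>\<^sub>E t\<in>T. carrier (FZ G))"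
        using PG.inv_closed[of w] sub[OF w] unfolding carrier_product_group by blast
      ultimately show ?thesis unfolding DD_carrier by blast
    qed
  qed
qed

lemma DD_eq: "\<D> = (product_group T (\<lambda>_. FZ G))\<lparr>carrier := carrier \<D>\<rparr>"
  by (simp add: DD_def)

lemma DD_group: "group \<D>"
  by (subst DD_eq) (rule subgroup.subgroup_is_group[OF DD_subgroup group_product_FZ])

lemma DD_mult: "v \<otimes>\<^bsub>\<D>\<^esub> w = v \<otimes>\<^bsub>product_group T (\<lambda>_. FZ G)\<^esub> w"
  by (simp add: DD_def)

lemma DD_mult_apply: "t \<in> T \<Longrightarrow> (v \<otimes>\<^bsub>\<D>\<^esub> w) t = v t \<otimes>\<^bsub>FR G\<^esub> w t"
  by (simp add: DD_mult FZ_mult)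

lemma DD_inv: "w \<in> carrier \<D> \<Longrightarrow> inv\<^bsub>\<D>\<^esub> w = inv\<^bsub>product_group T (\<lambda>_. FZ G)\<^esub> w"
  by (subst DD_eq) (rule group.m_inv_consistent[OF group_product_FZ DD_subgroup])

lemma DD_extensional: "w \<in> carrier \<D> \<Longrightarrow> w \<in> extensional T"
  by (auto simp: DD_carrier PiE_def)

lemma DD_profile_mult:
  "v \<in> carrier \<D> \<Longrightarrow> w \<in> carrier \<D> \<Longrightarrow> t \<in> T \<Longrightarrow>
    profile (v \<otimes>\<^bsub>\<D>\<^esub> w) t = profile v t \<otimes>\<^bsub>FR G\<^esub> profile w t"
  unfolding DD_mult by (rule profile_mult) (auto simp: DD_carrier)

lemma DD_profile_inv:
  "w \<in> carrier \<D> \<Longrightarrow> t \<in> T \<Longrightarrow> profile (inv\<^bsub>\<D>\<^esub> w) t = inv\<^bsub>FR G\<^esub> (profile w t)"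
  by (simp only: DD_inv) (rule profile_inv, auto simp: DD_carrier)

lemma DD_norm_tendsto:
  "w \<in> carrier \<D> \<Longrightarrow> ((\<lambda>t. fr_norm G N (profile w t)) \<longlongrightarrow> \<D>n w) E"
  using cauchy_norm_tendsto[OF DD_profile(2,1)] by (simp add: DD_norm_def profile_def)

lemma E_neq_bot: "E \<noteq> bot"
  by (rule at_top_in_neq_bot[OF scaling])

lemma eventually_T: "(\<And>t. t \<in> T \<Longrightarrow> Q t) \<Longrightarrow> \<forall>\<^sub>F t in E. Q t"
  by (auto simp: eventually_at_top_in)

text \<open>Inequalities between norms of profiles pass to the limit; this yields all axioms of the
  pseudonorm on the group of directions.\<close>

lemma limit_le:
  assumes "(f \<longlongrightarrow> a) E" "(g \<longlongrightarrow> b) E" "\<And>t. t \<in> T \<Longrightarrow> f t \<le> (g t :: real)"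
  shows "a \<le> b"
  by (rule tendsto_le[OF E_neq_bot assms(2,1) eventually_T[OF assms(3)]])

sublocale D: pseudonormed_group \<D> \<D>n
proof -
  interpret D: group \<D> by (rule DD_group)
  show "pseudonormed_group \<D> \<D>n"
  proof
    note lim = DD_norm_tendsto
    fix w assume w: "w \<in> carrier \<D>"
    note wP = funcset_mem[OF DD_profile(1)[OF w]]
    show "0 \<le> \<D>n w"
      by (rule limit_le[OF tendsto_const lim[OF w]]) (rule P.nonneg[OF wP])
    show "\<D>n (inv\<^bsub>\<D>\<^esub> w) \<le> \<D>n w"
      by (rule limit_le[OF lim[OF D.inv_closed[OF w]] lim[OF w]]) (simp add: DD_profile_inv[OF w] P.P_inv wP)
    fix v assume v: "v \<in> carrier \<D>"
    note vP = funcset_mem[OF DD_profile(1)[OF v]]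
    show "\<D>n (w \<otimes>\<^bsub>\<D>\<^esub> v) \<le> \<D>n w + \<D>n v"
      by (rule limit_le[OF lim[OF D.m_closed[OF w v]] tendsto_add[OF lim[OF w] lim[OF v]]])
        (simp add: DD_profile_mult[OF w v] P.P_mult wP vP)
    show "\<D>n (v \<otimes>\<^bsub>\<D>\<^esub> w \<otimes>\<^bsub>\<D>\<^esub> inv\<^bsub>\<D>\<^esub> v) \<le> \<D>n w"
      by (rule limit_le[OF lim lim[OF w]])
        (simp_all add: v w DD_profile_mult DD_profile_inv P.P_conj wP vP)
  next
    have "((\<lambda>t. fr_norm G N (profile \<one>\<^bsub>\<D>\<^esub> t)) \<longlongrightarrow> 0) E"
      by (rule tendsto_eventually[OF eventually_T])
        (simp add: profile_def DD_def FZ_one group_hom.hom_one[OF scale_hom] P.P_one)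
    then show "\<D>n \<one>\<^bsub>\<D>\<^esub> = 0"
      using tendsto_unique[OF E_neq_bot DD_norm_tendsto[OF D.one_closed]] by blast
  qed
qed

lemma DD_delta_tendsto:
  assumes v: "v \<in> carrier \<D>" and w: "w \<in> carrier \<D>"
  shows "((\<lambda>t. P.\<delta> (profile v t) (profile w t)) \<longlongrightarrow> D.\<delta> v w) E"
proof -
  have "\<forall>\<^sub>F t in E. fr_norm G N (profile (inv\<^bsub>\<D>\<^esub> v \<otimes>\<^bsub>\<D>\<^esub> w) t) = P.\<delta> (profile v t) (profile w t)"
    using v w funcset_mem[OF DD_profile(1)[OF v]] funcset_mem[OF DD_profile(1)[OF w]]
    by (intro eventually_T) (simp add: DD_profile_mult DD_profile_inv P.delta_eq)
  moreover have "((\<lambda>t. fr_norm G N (profile (inv\<^bsub>\<D>\<^esub> v \<otimes>\<^bsub>\<D>\<^esub> w) t)) \<longlongrightarrow> D.\<delta> v w) E"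
    using DD_norm_tendsto[of "inv\<^bsub>\<D>\<^esub> v \<otimes>\<^bsub>\<D>\<^esub> w"] v w by (simp add: D.delta_eq)
  ultimately show ?thesis by (rule Lim_transform_eventually[rotated])
qed

lemma DD_delta_zero_iff:
  assumes "v \<in> carrier \<D>" "w \<in> carrier \<D>"
  shows "D.\<delta> v w = 0 \<longleftrightarrow> profile v \<simeq> profile w"
proof
  show "profile v \<simeq> profile w" if "D.\<delta> v w = 0"
    using DD_delta_tendsto[OF assms] unfolding that .
  show "D.\<delta> v w = 0" if "profile v \<simeq> profile w"
    using tendsto_unique[OF E_neq_bot DD_delta_tendsto[OF assms] that] .
qed

section \<open>Constant directions\<close>

text \<open>The representative of \<open>iota x\<close>. Each exponent is off by at most 1 before rescaling by \<open>1 / t\<close>,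
  so its profile converges to \<open>x\<close>.\<close>

definition rounding :: "('a \<times> real) list \<Rightarrow> real \<Rightarrow> ('a \<times> real) list" where
  "rounding x = (\<lambda>t\<in>T. fr_eval (FR G) (\<lambda>g r. fr_gen g 1 [^]\<^bsub>FR G\<^esub> \<lfloor>t * r\<rfloor>) x)"

lemma rounding_eq:
  assumes x: "x \<in> carrier (FR G)" and t: "t \<in> T"
  shows "rounding x t = fr_eval (FR G) (\<lambda>g r. fr_gen g (of_int \<lfloor>t * r\<rfloor>)) x"
  using t unfolding rounding_def
  by (simp, intro eval_cong[OF FR_letters[OF x]]) (simp add: gen_int_pow)

lemma rounding_in_FZ:
  assumes x: "x \<in> carrier (FR G)"
  shows "rounding x \<in> (\<Pi>\<^sub>E t\<in>T. carrier (FZ G))"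
proof (rule PiE_I)
  show "rounding x t \<in> carrier (FZ G)" if "t \<in> T" for t
    unfolding rounding_eq[OF x that] using FR_letters[OF x] by (intro eval_in_FZ) auto
qed (simp add: rounding_def)

lemma rounding_approx:
  assumes x: "x \<in> carrier (FR G)"
  shows "profile (rounding x) \<simeq> (\<lambda>_. x)"
proof (rule approxI)
  have "((\<lambda>t. (\<Sum>(g, r)\<leftarrow>x. N g) * inverse t) \<longlongrightarrow> (\<Sum>(g, r)\<leftarrow>x. N g) * 0) E"
    by (intro tendsto_intros tendsto_inverse_0_at_top filterlim_at_top_in[OF scaling])
  then show "((\<lambda>t. (\<Sum>(g, r)\<leftarrow>x. N g) * inverse t) \<longlongrightarrow> 0) E" by simp
  fix t assume t: "t \<in> T"
  have "\<bar>1 / t * of_int \<lfloor>t * r\<rfloor> - r\<bar> * N g \<le> N g * inverse t" if "g \<in> carrier G" for g r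
  proof -
    have "1 / t * of_int \<lfloor>t * r\<rfloor> - r = (of_int \<lfloor>t * r\<rfloor> - t * r) * inverse t"
      using T_pos[OF t] by (simp add: field_simps)
    moreover have "\<bar>of_int \<lfloor>t * r\<rfloor> - t * r\<bar> \<le> 1" by linarith
    ultimately have "\<bar>1 / t * of_int \<lfloor>t * r\<rfloor> - r\<bar> \<le> inverse t"
      using mult_right_mono[of "\<bar>of_int \<lfloor>t * r\<rfloor> - t * r\<bar>" 1 "inverse t"] T_pos[OF t]
      by (simp add: abs_mult)
    from mult_right_mono[OF this weight_nonneg[OF that]] show ?thesis by (simp add: mult.commute)
  qed
  then have "(\<Sum>(g, r)\<leftarrow>x. \<bar>1 / t * of_int \<lfloor>t * r\<rfloor> - r\<bar> * N g) \<le> (\<Sum>(g, r)\<leftarrow>x. N g * inverse t)"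
    using FR_letters[OF x] by (intro sum_list_mono) auto
  also have "\<dots> = (\<Sum>(g, r)\<leftarrow>x. N g) * inverse t"
    by (simp add: case_prod_unfold sum_list_mult_const)
  finally show "P.\<delta> (profile (rounding x) t) x \<le> (\<Sum>(g, r)\<leftarrow>x. N g) * inverse t"
    using delta_eval[OF FR_letters[OF x], of "\<lambda>r. 1 / t * of_int \<lfloor>t * r\<rfloor>" "\<lambda>r. r"]
    by (simp add: profile_def rounding_eq[OF x t] scale_eval[OF FR_letters[OF x]] eval_gen[OF x])
qed

lemma rounding_closed:
  assumes x: "x \<in> carrier (FR G)"
  shows "rounding x \<in> carrier \<D>"
proof -
  have "cauchy (profile (rounding x))"
    by (rule cauchy_approx[OF cauchy_const[OF x] approx_sym[OF rounding_approx[OF x]]])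
      (use x profile_closed[OF rounding_in_FZ[OF x]] in auto)
  then show ?thesis using rounding_in_FZ[OF x] by (simp add: DD_carrier)
qed

text \<open>A direction \<open>w\<close> is approximated by the constant direction of a late value of its profile.\<close>

lemma rounding_dense:
  assumes w: "w \<in> carrier \<D>" and \<epsilon>: "0 < \<epsilon>"
  shows "\<exists>x\<in>carrier (FR G). D.\<delta> w (rounding x) \<le> \<epsilon>"
proof -
  obtain t0 where t0: "t0 \<in> T" "\<And>t. t \<in> T \<Longrightarrow> t0 \<le> t \<Longrightarrow> P.\<delta> (profile w t0) (profile w t) < \<epsilon>"
    using cauchy_center[OF DD_profile(2)[OF w] \<epsilon>] by blast
  let ?x = "profile w t0"
  have x: "?x \<in> carrier (FR G)" using t0(1) DD_profile(1)[OF w] by blast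
  have "D.\<delta> w (rounding ?x) \<le> \<epsilon>"
  proof (rule tendsto_le[OF E_neq_bot _ DD_delta_tendsto[OF w rounding_closed[OF x]]])
    show "((\<lambda>t. \<epsilon> + P.\<delta> (profile (rounding ?x) t) ?x) \<longlongrightarrow> \<epsilon>) E"
      using tendsto_add[OF tendsto_const rounding_approx[OF x]] by simp
    show "\<forall>\<^sub>F t in E. P.\<delta> (profile w t) (profile (rounding ?x) t) \<le> \<epsilon> + P.\<delta> (profile (rounding ?x) t) ?x"
      unfolding eventually_at_top_in
    proof (intro exI[of _ t0] ballI impI)
      fix t assume t: "t \<in> T" "t0 \<le> t"
      have "P.\<delta> (profile w t) (profile (rounding ?x) t)
          \<le> P.\<delta> (profile w t) ?x + P.\<delta> ?x (profile (rounding ?x) t)"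
        using t(1) x DD_profile(1)[OF w] DD_profile(1)[OF rounding_closed[OF x]]
        by (intro P.delta_triangle) auto
      then show "P.\<delta> (profile w t) (profile (rounding ?x) t) \<le> \<epsilon> + P.\<delta> (profile (rounding ?x) t) ?x"
        using t0(2)[OF t] by (simp add: P.delta_sym)
    qed
  qed
  then show ?thesis using x by blast
qed

end

section \<open>Dilations from ampleness\<close>

locale ample_cone = directional_cone +
  assumes ample: "ample T"
begin

text \<open>A reparametrization with asymptotic slope \<open>\<bar>s\<bar>\<close>. For \<open>s = 0\<close> the slope comes from the factor
  \<open>sgn s = 0\<close> of the dilation instead, and the identity is chosen because it tends to infinity.\<close>

definition reparam :: "real \<Rightarrow> real \<Rightarrow> real" where
  "reparam s = (if s = 0 then \<lambda>t. t
     else SOME \<sigma>. \<sigma> \<in> T \<rightarrow> T \<and> ((\<lambda>t. \<sigma> t / t) \<longlongrightarrow> \<bar>s\<bar>) E)"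

lemma reparam_closed: "reparam s \<in> T \<rightarrow> T"
  and reparam_ratio: "((\<lambda>t. sgn s * reparam s t / t) \<longlongrightarrow> s) E"
  and reparam_at_top: "filterlim (reparam s) at_top E"
proof -
  have "reparam s \<in> T \<rightarrow> T \<and> ((\<lambda>t. sgn s * reparam s t / t) \<longlongrightarrow> s) E \<and> filterlim (reparam s) at_top E"
  proof (cases "s = 0")
    case True
    then show ?thesis using filterlim_at_top_in[OF scaling] by (simp add: reparam_def)
  next
    case False
    then have "\<exists>\<sigma>. \<sigma> \<in> T \<rightarrow> T \<and> ((\<lambda>t. \<sigma> t / t) \<longlongrightarrow> \<bar>s\<bar>) E"
      using ample unfolding ample_def by simp
    from someI_ex[OF this] False
    have r: "reparam s \<in> T \<rightarrow> T" "((\<lambda>t. reparam s t / t) \<longlongrightarrow> \<bar>s\<bar>) E"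
      by (simp_all add: reparam_def)
    from tendsto_mult_left[OF r(2), of "sgn s"]
    have "((\<lambda>t. sgn s * reparam s t / t) \<longlongrightarrow> s) E"
      by (simp add: sgn_mult_abs)
    moreover have "filterlim (reparam s) at_top E"
      using ample_reparametrization[OF scaling r(2)] False by simp
    ultimately show ?thesis using r(1) by blast
  qed
  then show "reparam s \<in> T \<rightarrow> T" "((\<lambda>t. sgn s * reparam s t / t) \<longlongrightarrow> s) E"
    "filterlim (reparam s) at_top E" by blast+
qed

text \<open>The dilation by \<open>s\<close> on the level of directions. The scalar \<open>sgn s\<close> is an integer, so
  integrality of the exponents is preserved, while the absolute value of \<open>s\<close> is realized by
  the change of parameter.\<close>

definition dil :: "real \<Rightarrow> (real \<Rightarrow> ('a \<times> real) list) \<Rightarrow> real \<Rightarrow> ('a \<times> real) list" where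
  "dil s w = (\<lambda>t\<in>T. \<psi> (sgn s) (w (reparam s t)))"

lemma dil_PiE:
  assumes "w \<in> (\<Pi>\<^sub>E t\<in>T. carrier (FZ G))"
  shows "dil s w \<in> (\<Pi>\<^sub>E t\<in>T. carrier (FZ G))"
proof (rule PiE_I)
  fix t assume t: "t \<in> T"
  have "sgn s \<in> \<int>" by (simp add: sgn_if)
  moreover have "w (reparam s t) \<in> carrier (FZ G)"
    using assms funcset_mem[OF reparam_closed t] by (rule PiE_mem)
  ultimately show "dil s w t \<in> carrier (FZ G)" using t by (simp add: dil_def scale_in_FZ)
qed (simp add: dil_def)

text \<open>Dividing by \<open>t\<close> after evaluating at \<open>\<sigma> t\<close> amounts to dividing by \<open>\<sigma> t\<close> and then multiplying
  by \<open>\<sigma> t / t\<close>, which tends to \<open>\<bar>s\<bar>\<close>; here \<open>\<sigma>\<close> is the reparametrization.\<close>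

lemma profile_dil:
  assumes w: "w \<in> carrier \<D>" and t: "t \<in> T"
  shows "profile (dil s w) t = \<psi> (sgn s * reparam s t / t) (profile w (reparam s t))"
proof -
  have r: "reparam s t \<in> T" using reparam_closed t by blast
  have "w (reparam s t) \<in> carrier (FR G)" by (rule FZ_closed[OF DD_in_FZ[OF w r]])
  then show ?thesis
    using t T_pos[OF r] by (simp add: profile_def dil_def scale_scale mult.commute)
qed

lemma profile_dil_approx:
  assumes w: "w \<in> carrier \<D>"
  shows "profile (dil s w) \<simeq> (\<lambda>t. \<psi> s (profile w t))"
proof -
  have "(\<lambda>t. \<psi> (sgn s * reparam s t / t) (profile w (reparam s t))) \<simeq> (\<lambda>t. \<psi> s (profile w t))"
    by (rule reparametrized_approx[OF DD_profile(2,1)[OF w] reparam_ratio reparam_closed reparam_at_top])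
  moreover have "\<forall>\<^sub>F t in E. P.\<delta> (\<psi> (sgn s * reparam s t / t) (profile w (reparam s t))) (\<psi> s (profile w t))
      = P.\<delta> (profile (dil s w) t) (\<psi> s (profile w t))"
    by (rule eventually_T) (simp add: profile_dil[OF w])
  ultimately show ?thesis by (rule Lim_transform_eventually)
qed

lemma scaled_profile_closed: "w \<in> carrier \<D> \<Longrightarrow> (\<lambda>t. \<psi> s (profile w t)) \<in> T \<rightarrow> carrier (FR G)"
  using DD_profile(1)[of w] by (auto intro: scale_closed)

lemma dil_closed:
  assumes w: "w \<in> carrier \<D>"
  shows "dil s w \<in> carrier \<D>"
proof -
  have p: "dil s w \<in> (\<Pi>\<^sub>E t\<in>T. carrier (FZ G))" using w by (intro dil_PiE) (simp add: DD_carrier)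
  have "cauchy (profile (dil s w))"
    using cauchy_approx[OF cauchy_scale[OF DD_profile(2,1)[OF w]] approx_sym[OF profile_dil_approx[OF w]]
        scaled_profile_closed[OF w] profile_closed[OF p]] .
  then show ?thesis using p by (simp add: DD_carrier)
qed

text \<open>A profile may be replaced by any asymptotically equal family when a distance between
  directions is computed. For a dilated direction this is the family \<open>\<psi> s (profile w t)\<close>, in which
  the chosen reparametrization no longer occurs.\<close>

lemma approx_delta_tendsto:
  assumes v: "v \<in> carrier \<D>" and w: "w \<in> carrier \<D>"
    and f: "profile v \<simeq> f" "f \<in> T \<rightarrow> carrier (FR G)" and g: "profile w \<simeq> g" "g \<in> T \<rightarrow> carrier (FR G)"
  shows "((\<lambda>t. P.\<delta> (f t) (g t)) \<longlongrightarrow> D.\<delta> v w) E"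
proof -
  have "((\<lambda>t. P.\<delta> (f t) (g t) - P.\<delta> (profile v t) (profile w t)) \<longlongrightarrow> 0) E"
  proof (rule tendsto_rabs_zero_cancel, rule tendsto_sandwich[OF _ _ tendsto_const])
    show "((\<lambda>t. P.\<delta> (profile v t) (f t) + P.\<delta> (profile w t) (g t)) \<longlongrightarrow> 0) E"
      using tendsto_add[OF f(1) g(1)] by simp
    show "\<forall>\<^sub>F t in E. \<bar>P.\<delta> (f t) (g t) - P.\<delta> (profile v t) (profile w t)\<bar>
        \<le> P.\<delta> (profile v t) (f t) + P.\<delta> (profile w t) (g t)"
    proof (rule eventually_T)
      fix t assume t: "t \<in> T"
      note c = funcset_mem[OF DD_profile(1)[OF v] t] funcset_mem[OF DD_profile(1)[OF w] t]
        funcset_mem[OF f(2) t] funcset_mem[OF g(2) t]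
      show "\<bar>P.\<delta> (f t) (g t) - P.\<delta> (profile v t) (profile w t)\<bar>
          \<le> P.\<delta> (profile v t) (f t) + P.\<delta> (profile w t) (g t)"
        using P.delta_triangle[OF c(3,1,4)] P.delta_triangle[OF c(1,2,4)]
          P.delta_triangle[OF c(1,3,2)] P.delta_triangle[OF c(3,4,2)]
        by (simp add: P.delta_sym[of "f t" "profile v t"] P.delta_sym[of "g t" "profile w t"])
    qed
  qed simp
  from tendsto_add[OF this DD_delta_tendsto[OF v w]] show ?thesis by simp
qed

lemma dil_delta_tendsto:
  assumes v: "v \<in> carrier \<D>" and w: "w \<in> carrier \<D>"
  shows "((\<lambda>u. P.\<delta> (\<psi> s (profile v u)) (\<psi> t (profile w u))) \<longlongrightarrow> D.\<delta> (dil s v) (dil t w)) E"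
  by (rule approx_delta_tendsto[OF dil_closed[OF v] dil_closed[OF w] profile_dil_approx[OF v]
        scaled_profile_closed[OF v] profile_dil_approx[OF w] scaled_profile_closed[OF w]])

lemma dil_hom: "dil s \<in> hom \<D> \<D>"
proof (rule homI)
  show "dil s (v \<otimes>\<^bsub>\<D>\<^esub> w) = dil s v \<otimes>\<^bsub>\<D>\<^esub> dil s w" if v: "v \<in> carrier \<D>" and w: "w \<in> carrier \<D>" for v w
  proof (rule extensionalityI)
    show "dil s (v \<otimes>\<^bsub>\<D>\<^esub> w) \<in> extensional T" by (simp add: dil_def)
    show "dil s v \<otimes>\<^bsub>\<D>\<^esub> dil s w \<in> extensional T"
      using DD_extensional[OF D.m_closed[OF dil_closed[OF v] dil_closed[OF w]]] .
    fix t assume t: "t \<in> T"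
    have r: "reparam s t \<in> T" using reparam_closed t by blast
    show "dil s (v \<otimes>\<^bsub>\<D>\<^esub> w) t = (dil s v \<otimes>\<^bsub>\<D>\<^esub> dil s w) t"
      using t r FZ_closed[OF DD_in_FZ[OF v r]] FZ_closed[OF DD_in_FZ[OF w r]]
      by (simp add: DD_mult_apply) (simp add: dil_def DD_mult_apply scale_mult)
  qed
qed (rule dil_closed)

lemma dil_norm_le:
  assumes w: "w \<in> carrier \<D>"
  shows "\<D>n (dil s w) \<le> \<bar>s\<bar> * \<D>n w"
proof (rule limit_le[OF DD_norm_tendsto[OF dil_closed[OF w]]])
  show "((\<lambda>t. P.\<delta> (profile (dil s w) t) (\<psi> s (profile w t)) + \<bar>s\<bar> * fr_norm G N (profile w t))
      \<longlongrightarrow> \<bar>s\<bar> * \<D>n w) E"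
    using tendsto_add[OF profile_dil_approx[OF w] tendsto_mult_left[OF DD_norm_tendsto[OF w], of "\<bar>s\<bar>"], of s]
    by simp
  fix t assume t: "t \<in> T"
  note c = funcset_mem[OF DD_profile(1)[OF w] t]
  show "fr_norm G N (profile (dil s w) t)
      \<le> P.\<delta> (profile (dil s w) t) (\<psi> s (profile w t)) + \<bar>s\<bar> * fr_norm G N (profile w t)"
    using P.P_delta[OF funcset_mem[OF DD_profile(1)[OF dil_closed[OF w, of s]] t] scale_closed[OF c, of s]]
      norm_scale[OF c, of s] by linarith
qed

text \<open>The orbit of a constant direction is Lipschitz with constant \<open>len x\<close>, and the dilations are
  Lipschitz, so the orbit of any \<open>w\<close> is controlled by an approximating constant direction.\<close>

lemma dil_orbit_bound:
  assumes w: "w \<in> carrier \<D>" and x: "x \<in> carrier (FR G)"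
  shows "D.\<delta> (dil s w) (dil t w) \<le> (\<bar>s\<bar> + \<bar>t\<bar>) * D.\<delta> w (rounding x) + \<bar>s - t\<bar> * len x"
proof (rule limit_le[OF dil_delta_tendsto[OF w w]])
  have cx: "(\<lambda>_. x) \<in> T \<rightarrow> carrier (FR G)" using x by auto
  have "((\<lambda>u. P.\<delta> (profile w u) x) \<longlongrightarrow> D.\<delta> w (rounding x)) E"
    by (rule approx_delta_tendsto[OF w rounding_closed[OF x] _ DD_profile(1)[OF w] rounding_approx[OF x] cx])
      simp
  then show "((\<lambda>u. (\<bar>s\<bar> + \<bar>t\<bar>) * P.\<delta> (profile w u) x + \<bar>s - t\<bar> * len x)
      \<longlongrightarrow> (\<bar>s\<bar> + \<bar>t\<bar>) * D.\<delta> w (rounding x) + \<bar>s - t\<bar> * len x) E"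
    by (intro tendsto_intros)
  fix u assume u: "u \<in> T"
  note c = funcset_mem[OF DD_profile(1)[OF w] u]
  have "P.\<delta> (\<psi> s (profile w u)) (\<psi> t (profile w u))
      \<le> P.\<delta> (\<psi> s (profile w u)) (\<psi> s x) + P.\<delta> (\<psi> s x) (\<psi> t x) + P.\<delta> (\<psi> t x) (\<psi> t (profile w u))"
    using P.delta_triangle[OF scale_closed[OF c] scale_closed[OF x] scale_closed[OF c], of s t s]
      P.delta_triangle[OF scale_closed[OF x] scale_closed[OF x] scale_closed[OF c], of s t t] by simp
  also have "\<dots> \<le> \<bar>s\<bar> * P.\<delta> (profile w u) x + \<bar>s - t\<bar> * len x + \<bar>t\<bar> * P.\<delta> (profile w u) x"
    using delta_scale[OF c x, of s] delta_scale[OF x c, of t] delta_scale_param[OF x, of s t]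
    by (simp add: P.delta_sym[of x])
  finally show "P.\<delta> (\<psi> s (profile w u)) (\<psi> t (profile w u))
      \<le> (\<bar>s\<bar> + \<bar>t\<bar>) * P.\<delta> (profile w u) x + \<bar>s - t\<bar> * len x"
    by (simp add: algebra_simps)
qed

lemma dil_orbit_continuous:
  assumes w: "w \<in> carrier \<D>"
  shows "((\<lambda>t. D.\<delta> (dil s w) (dil t w)) \<longlongrightarrow> 0) (at s)"
proof (rule tendstoI)
  fix \<epsilon> :: real assume \<epsilon>: "0 < \<epsilon>"
  define a where "a = 2 * \<bar>s\<bar> + 1"
  have a: "0 < a" by (simp add: a_def)
  obtain x where x: "x \<in> carrier (FR G)" and wx: "D.\<delta> w (rounding x) \<le> \<epsilon> / (4 * a)"
    using rounding_dense[OF w, of "\<epsilon> / (4 * a)"] \<epsilon> a by auto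
  have "((\<lambda>t. \<bar>s - t\<bar> * len x) \<longlongrightarrow> \<bar>s - s\<bar> * len x) (at s)"
    by (intro tendsto_intros)
  then have "\<forall>\<^sub>F t in at s. \<bar>s - t\<bar> * len x < \<epsilon> / 2"
    using \<epsilon> by (intro order_tendstoD) auto
  moreover have "\<forall>\<^sub>F t in at s. \<bar>t - s\<bar> < 1"
    using eventually_at_ball[of 1 s UNIV] by (simp add: dist_real_def abs_minus_commute)
  ultimately show "\<forall>\<^sub>F t in at s. dist (D.\<delta> (dil s w) (dil t w)) 0 < \<epsilon>"
  proof eventually_elim
    case (elim t)
    have "\<bar>s\<bar> + \<bar>t\<bar> \<le> a" using elim(2) by (simp add: a_def)
    then have "(\<bar>s\<bar> + \<bar>t\<bar>) * D.\<delta> w (rounding x) \<le> a * (\<epsilon> / (4 * a))"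
      using wx a by (intro mult_mono D.delta_nonneg) auto
    also have "a * (\<epsilon> / (4 * a)) = \<epsilon> / 4" using a by simp
    finally show ?case
      using dil_orbit_bound[OF w x, of s t] elim(1) D.delta_nonneg \<epsilon> by simp
  qed
qed

sublocale DD: dilated_group \<D> \<D>n UNIV dil
proof
  show "D.\<delta> (dil 1 w) w = 0" if w: "w \<in> carrier \<D>" for w
  proof -
    have "profile (dil 1 w) \<simeq> (\<lambda>t. \<psi> 1 (profile w t))" by (rule profile_dil_approx[OF w])
    moreover have "\<forall>\<^sub>F t in E. P.\<delta> (profile (dil 1 w) t) (\<psi> 1 (profile w t))
        = P.\<delta> (profile (dil 1 w) t) (profile w t)"
      by (rule eventually_T) (simp add: scale_one funcset_mem[OF DD_profile(1)[OF w]])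
    ultimately have "profile (dil 1 w) \<simeq> profile w" by (rule Lim_transform_eventually)
    then show ?thesis by (simp add: DD_delta_zero_iff dil_closed w)
  qed
  show "D.\<delta> (dil s (dil t w)) (dil (s * t) w) = 0" if w: "w \<in> carrier \<D>" for s t w
  proof -
    note dw = dil_closed[OF w, of t]
    have e: "\<forall>\<^sub>F u in E. P.\<delta> (\<psi> s (profile (dil t w) u)) (\<psi> s (\<psi> t (profile w u)))
        = P.\<delta> (\<psi> s (profile (dil t w) u)) (\<psi> (s * t) (profile w u))"
      by (rule eventually_T) (simp add: scale_scale funcset_mem[OF DD_profile(1)[OF w]])
    have "(\<lambda>u. \<psi> s (profile (dil t w) u)) \<simeq> (\<lambda>u. \<psi> s (\<psi> t (profile w u)))"
      by (rule approx_scale[OF profile_dil_approx[OF w] DD_profile(1)[OF dw] scaled_profile_closed[OF w]])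
    from Lim_transform_eventually[OF this e]
    show ?thesis using tendsto_unique[OF E_neq_bot dil_delta_tendsto[OF dw w]] by blast
  qed
qed (simp_all add: dil_hom dil_norm_le dil_orbit_continuous)

text \<open>Both sides represent the element \<open>\<psi> s x\<close>; this identifies the dilations with the map
  extended from the free product.\<close>

lemma dil_rounding:
  assumes x: "x \<in> carrier (FR G)"
  shows "D.\<delta> (dil s (rounding x)) (rounding (\<psi> s x)) = 0"
proof -
  note rx = rounding_closed[OF x]
  have cx: "(\<lambda>_. x) \<in> T \<rightarrow> carrier (FR G)" "(\<lambda>_. \<psi> s x) \<in> T \<rightarrow> carrier (FR G)"
    using x scale_closed[OF x] by auto
  have 1: "(\<lambda>t. \<psi> s (profile (rounding x) t)) \<simeq> (\<lambda>t. \<psi> s x)"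
    by (rule approx_scale[OF rounding_approx[OF x] DD_profile(1)[OF rx] cx(1)])
  have "((\<lambda>t. P.\<delta> (\<psi> s (profile (rounding x) t)) (\<psi> s x))
      \<longlongrightarrow> D.\<delta> (dil s (rounding x)) (rounding (\<psi> s x))) E"
    by (rule approx_delta_tendsto[OF dil_closed[OF rx] rounding_closed[OF scale_closed[OF x]]
          profile_dil_approx[OF rx] scaled_profile_closed[OF rx] rounding_approx[OF scale_closed[OF x]] cx(2)])
  then show ?thesis using tendsto_unique[OF E_neq_bot _ 1] by blast
qed

section \<open>The dilations of the completed group of directions\<close>

abbreviation "\<D>h \<equiv> DD_hat G N T"
abbreviation "\<D>top \<equiv> group_topology \<D>h (DD_hat_norm G N T)"

lemma iota_eq: "iota G N T x = null_class \<D> \<D>n (rounding x)"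
  by (simp add: iota_def rounding_def)

lemma metric_DD_hat: "Metric_space (carrier \<D>h) (group_dist \<D>h (DD_hat_norm G N T))"
  unfolding DD_hat_def DD_hat_norm_def by (rule D.metric_quotient)

lemma topspace_DD_hat: "topspace \<D>top = carrier \<D>h"
  unfolding group_topology_def by (rule Metric_space.topspace_mtopology[OF metric_DD_hat])

lemma iota_dense: "carrier \<D>h \<subseteq> \<D>top closure_of (iota G N T ` carrier (FR G))"
proof
  interpret M: Metric_space "carrier \<D>h" "group_dist \<D>h (DD_hat_norm G N T)" by (rule metric_DD_hat)
  fix X assume X: "X \<in> carrier \<D>h"
  then obtain w where w: "w \<in> carrier \<D>" "X = null_class \<D> \<D>n w"
    by (auto simp: DD_hat_def D.carrier_quotient)
  show "X \<in> \<D>top closure_of (iota G N T ` carrier (FR G))"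
    unfolding group_topology_def M.metric_closure_of
  proof (intro CollectI conjI X allI impI)
    fix r :: real assume r: "0 < r"
    then obtain x where x: "x \<in> carrier (FR G)" "D.\<delta> w (rounding x) \<le> r / 2"
      using rounding_dense[OF w(1), of "r / 2"] by auto
    have "group_dist \<D>h (DD_hat_norm G N T) X (iota G N T x) = D.\<delta> w (rounding x)"
      using x(1) w by (simp add: iota_eq DD_hat_def DD_hat_norm_def D.delta_class rounding_closed)
    moreover have "iota G N T x \<in> carrier \<D>h"
      using D.class_closed[OF rounding_closed[OF x(1)]] by (simp add: iota_eq DD_hat_def)
    ultimately have "iota G N T x \<in> M.mball X r"
      using x(2) r X by simp
    then show "\<exists>y\<in>iota G N T ` carrier (FR G). y \<in> M.mball X r" using x(1) by blast
  qed
qed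

text \<open>The explicit dilations satisfy the characterizing property of \<open>dilation\<close>. Uniqueness holds because,
  for each fixed scalar, two such maps are continuous into a Hausdorff space and agree on a dense set.\<close>

lemma dilation_eq: "dilation G N T = restrict DD.descent (UNIV \<times> carrier \<D>h)"
  unfolding dilation_def
proof (rule the_equality, intro conjI allI ballI)
  let ?h = "restrict DD.descent (UNIV \<times> carrier \<D>h)"
  let ?X = "prod_topology euclideanreal \<D>top"
  show "?h \<in> extensional (UNIV \<times> carrier \<D>h)" by simp
  have "continuous_map ?X \<D>top DD.descent"
    using DD.descent_continuous by (simp add: DD_hat_def DD_hat_norm_def)
  then show h: "continuous_map ?X \<D>top ?h"
    by (rule continuous_map_eq) (simp add: topspace_DD_hat)
  show hi: "?h (s, iota G N T x) = iota G N T (\<psi> s x)" if x: "x \<in> carrier (FR G)" for s x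
    using x dil_rounding[OF x, of s] D.class_closed[OF rounding_closed[OF x]]
    by (simp add: iota_eq DD_hat_def DD.descent_class rounding_closed dil_closed scale_closed
        D.null_class_eq_iff)
  fix k
  assume k: "k \<in> extensional (UNIV \<times> carrier \<D>h) \<and> continuous_map ?X \<D>top k \<and>
    (\<forall>t. \<forall>x\<in>carrier (FR G). k (t, iota G N T x) = iota G N T (\<psi> t x))"
  have slice: "continuous_map \<D>top \<D>top (\<lambda>X. f (s, X))" if "continuous_map ?X \<D>top f" for f s
  proof -
    have "continuous_map \<D>top \<D>top (f \<circ> (\<lambda>X. (s, X)))"
      by (intro continuous_map_compose[OF _ that] continuous_map_pairedI) auto
    then show ?thesis by (simp add: comp_def)
  qed
  show "k = ?h"
  proof (rule extensionalityI)
    fix z :: "real \<times> (real \<Rightarrow> ('a \<times> real) list) set"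
    assume "z \<in> UNIV \<times> carrier \<D>h"
    then obtain s X where z: "z = (s, X)" and X: "X \<in> carrier \<D>h" by blast
    have "k (s, X) = ?h (s, X)"
    proof (rule forall_in_closure_of_eq[where f = "\<lambda>X. k (s, X)" and g = "\<lambda>X. ?h (s, X)"])
      show "X \<in> \<D>top closure_of (iota G N T ` carrier (FR G))" using X iota_dense by blast
      show "Hausdorff_space \<D>top"
        unfolding group_topology_def by (rule Metric_space.Hausdorff_space_mtopology[OF metric_DD_hat])
      show "continuous_map \<D>top \<D>top (\<lambda>X. k (s, X))" using k by (intro slice) blast
      show "continuous_map \<D>top \<D>top (\<lambda>X. ?h (s, X))" by (rule slice[OF h])
      fix Y assume "Y \<in> iota G N T ` carrier (FR G)"
      then obtain x where "x \<in> carrier (FR G)" "Y = iota G N T x" by blast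
      then show "k (s, Y) = ?h (s, Y)" using k hi[of x s] by metis
    qed
    then show "k z = ?h z" by (simp add: z)
  qed (use k in auto)
qed

section \<open>Dilations of the directional asymptotic cone\<close>

abbreviation "\<C> \<equiv> CC G N T"
abbreviation "\<C>n \<equiv> CC_norm G N T"

lemma push_hom: "push G T \<in> hom \<D> (product_group T (\<lambda>_. G))"
proof (rule homI)
  note p = fz_proj_hom(1)[OF group_G]
  show "push G T w \<in> carrier (product_group T (\<lambda>_. G))" if w: "w \<in> carrier \<D>" for w
    using hom_in_carrier[OF p DD_in_FZ[OF w]] by (simp add: push_def)
  show "push G T (v \<otimes>\<^bsub>\<D>\<^esub> w) = push G T v \<otimes>\<^bsub>product_group T (\<lambda>_. G)\<^esub> push G T w"
    if v: "v \<in> carrier \<D>" and w: "w \<in> carrier \<D>" for v w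
    using hom_mult[OF p DD_in_FZ[OF v] DD_in_FZ[OF w]]
    by (auto simp: push_def DD_mult_apply FZ_mult intro!: restrict_ext)
qed

lemma product_group_G: "group (product_group T (\<lambda>_. G))"
  by (simp add: group_G)

lemma CC_carrier: "carrier \<C> = push G T ` carrier \<D>"
  by (simp add: CC_def)

lemma CC_eq: "\<C> = (product_group T (\<lambda>_. G))\<lparr>carrier := carrier \<C>\<rparr>"
  by (simp add: CC_def)

lemma CC_group: "group \<C>"
proof -
  interpret group_hom \<D> "product_group T (\<lambda>_. G)" "push G T"
    using push_hom product_group_G DD_group by (simp add: group_hom_def group_hom_axioms_def)
  show ?thesis
    by (subst CC_eq) (rule subgroup.subgroup_is_group[OF _ product_group_G],
        simp add: CC_carrier img_is_subgroup)
qed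

lemma push_hom_CC: "push G T \<in> hom \<D> \<C>"
  using push_hom by (auto simp: hom_def CC_carrier CC_def)

text \<open>Reparametrization makes sense for functions with values in \<open>G\<close> too, where no exponents are left
  to be rescaled.\<close>

definition cdil :: "real \<Rightarrow> (real \<Rightarrow> 'a) \<Rightarrow> real \<Rightarrow> 'a" where
  "cdil s g = (if s = 0 then \<one>\<^bsub>\<C>\<^esub> else (\<lambda>t\<in>T. g (reparam s t)))"

lemma scale_zero: "x \<in> carrier (FR G) \<Longrightarrow> \<psi> 0 x = \<one>\<^bsub>FR G\<^esub>"
proof -
  have "fr_eval (FR G) (\<lambda>g r. fr_gen g (0 * r)) w = \<one>\<^bsub>FR G\<^esub>" for w :: "('a \<times> real) list"
    by (induction w) (auto simp: eval_Cons gen_zero, simp add: fr_eval_def)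
  then show ?thesis by (simp add: fr_scale_def)
qed

text \<open>The point of the construction. For \<open>s > 0\<close> the dilation only reindexes the values of \<open>w\<close>, hence
  commutes with applying the projection to each value; for \<open>s = 0\<close> both sides are trivial. For
  \<open>s < 0\<close> it also applies \<open>\<psi> (-1)\<close>, which need not preserve the kernel of the projection.\<close>

lemma push_dil:
  assumes s: "s \<in> {0..}" and w: "w \<in> carrier \<D>"
  shows "cdil s (push G T w) = push G T (dil s w)"
proof -
  have r: "reparam s t \<in> T" if "t \<in> T" for t using reparam_closed that by blast
  have c: "w (reparam s t) \<in> carrier (FR G)" if "t \<in> T" for t
    by (rule FZ_closed[OF DD_in_FZ[OF w r[OF that]]])
  show ?thesis
  proof (cases "s = 0")
    case True
    have "fz_proj G \<one>\<^bsub>FR G\<^esub> = \<one>\<^bsub>G\<^esub>"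
      by (simp add: fz_proj_def fr_eval_def FR_def)
    then show ?thesis using True c by (auto simp: cdil_def push_def dil_def scale_zero CC_def)
  next
    case False
    then show ?thesis using s r c by (auto simp: cdil_def push_def dil_def scale_one)
  qed
qed

lemma CC_norm_eq: "\<C>n g = Inf {\<D>n w | w. w \<in> carrier \<D> \<and> push G T w = g}"
  by (simp add: CC_norm_def)

sublocale CC: dilated_group \<C> \<C>n "{0..}" cdil
  by (rule dilated_image[OF DD.dilated_group_axioms CC_group push_hom_CC CC_carrier[symmetric]
        CC_norm_eq]) (simp_all add: push_dil)

lemma proj_hat_class:
  assumes w: "w \<in> carrier \<D>"
  shows "proj_hat G N T (null_class \<D> \<D>n w) = null_class \<C> \<C>n (push G T w)"
  unfolding proj_hat_def
proof (rule D.the_elem_null_class[OF w])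
  fix v assume v: "v \<in> carrier \<D>" and 0: "D.\<delta> w v = 0"
  note im = pseudonormed_image[OF D.pseudonormed_group_axioms CC_group push_hom_CC CC_carrier[symmetric]
      CC_norm_eq]
  have "CC.\<delta> (push G T w) (push G T v) \<le> 1 * D.\<delta> w v"
    by (rule D.hom_contracts_delta[OF CC.pseudonormed_group_axioms push_hom_CC _ w v]) (simp add: im(2))
  then have "CC.\<delta> (push G T w) (push G T v) = 0"
    using 0 CC.delta_nonneg[of "push G T w" "push G T v"] by simp
  then show "null_class \<C> \<C>n (push G T v) = null_class \<C> \<C>n (push G T w)"
    using CC.null_class_eq_iff[OF hom_in_carrier[OF push_hom_CC w] hom_in_carrier[OF push_hom_CC v]] by simp
qed

lemma descent_proj_hat:
  assumes s: "0 \<le> s" and X: "X \<in> carrier \<D>h"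
  shows "CC.descent (s, proj_hat G N T X) = proj_hat G N T (dilation G N T (s, X))"
proof -
  obtain w where w: "w \<in> carrier \<D>" "X = null_class \<D> \<D>n w"
    using X by (auto simp: DD_hat_def D.carrier_quotient)
  have "dilation G N T (s, X) = null_class \<D> \<D>n (dil s w)"
    using X w by (simp add: dilation_eq DD.descent_class)
  then show ?thesis
    using s w push_dil[of s w]
    by (simp add: proj_hat_class dil_closed CC.descent_class hom_in_carrier[OF push_hom_CC])
qed

end

theorem theorem6p10:
  fixes G :: "('a, 'b) monoid_scheme" and N :: "'a \<Rightarrow> real" and T :: "real set"
  assumes "group G" and "conj_inv_norm G N" and "scaling_set T" and "ample T"
  shows "(\<exists>hh :: real \<times> (real \<Rightarrow> 'a) set \<Rightarrow> (real \<Rightarrow> 'a) set.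
            continuous_map
              (prod_topology (top_of_set {0..}) (group_topology (CC_hat G N T) (CC_hat_norm G N T)))
              (group_topology (CC_hat G N T) (CC_hat_norm G N T)) hh
          \<and> (\<forall>t\<ge>0. \<forall>x\<in>carrier (DD_hat G N T).
               hh (t, proj_hat G N T x) = proj_hat G N T (dilation G N T (t, x)))
          \<and> (\<forall>t\<ge>0. (\<lambda>x. hh (t, x)) \<in> hom (CC_hat G N T) (CC_hat G N T))
          \<and> (\<forall>t\<ge>0. \<forall>x\<in>carrier (CC_hat G N T).
               CC_hat_norm G N T (hh (t, x)) = t * CC_hat_norm G N T x)
          \<and> (\<forall>x\<in>carrier (CC_hat G N T). hh (1, x) = x)
          \<and> (\<forall>x\<in>carrier (CC_hat G N T). hh (0, x) = \<one>\<^bsub>CC_hat G N T\<^esub>)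
          \<and> (\<forall>t\<ge>0. \<forall>s\<ge>0. \<forall>x\<in>carrier (CC_hat G N T). hh (t, hh (s, x)) = hh (t * s, x)))
       \<and> contractible_space (group_topology (CC_hat G N T) (CC_hat_norm G N T))
       \<and> contractible_space
           (End_topology (CC_hat G N T) (group_topology (CC_hat G N T) (CC_hat_norm G N T)))"
proof -
  interpret ample_cone G N T
    using assms
    by (intro ample_cone.intro directional_cone.intro weighted_letters.intro
        directional_cone_axioms.intro ample_cone_axioms.intro) (simp_all add: conj_inv_norm_def)
  let ?C = "CC_hat G N T" and ?X = "group_topology (CC_hat G N T) (CC_hat_norm G N T)"
  note [simp] = CC_hat_def CC_hat_norm_def
  have cont: "continuous_map (prod_topology (top_of_set {0..}) ?X) ?X CC.descent"
    using CC.descent_continuous by simp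
  \<comment> \<open>The action of the scalars in the unit interval contracts the cone to its unit.\<close>
  have "continuous_map (subtopology (prod_topology (top_of_set {0..}) ?X) ({0..1} \<times> UNIV)) ?X CC.descent"
    using cont by (rule continuous_map_from_subtopology)
  moreover have "{0..} \<inter> {0..1} = {0..1::real}" by auto
  then have "subtopology (prod_topology (top_of_set {0..}) ?X) ({0..1} \<times> UNIV)
      = prod_topology (top_of_set {0..1::real}) ?X"
    by (simp add: subtopology_Times subtopology_subtopology)
  ultimately have cont1: "continuous_map (prod_topology (top_of_set {0..1}) ?X) ?X CC.descent"
    by simp
  have top: "topspace ?X = carrier ?C"
    using Metric_space.topspace_mtopology[OF CC.metric_quotient] by (simp add: group_topology_def)
  have "contractible_space ?X"
    by (rule contractible_space_if_scaled_to_point[OF cont1])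
      (simp_all only: top, simp_all add: CC.descent_one CC.descent_zero)
  moreover have "contractible_space (End_topology ?C ?X)"
    by (rule contractible_space_End[OF _ top cont1])
      (simp_all only: top, simp_all add: CC.descent_one CC.descent_zero CC.descent_hom CC.group_quotient)
  moreover have "CC.descent (t, proj_hat G N T x) = proj_hat G N T (dilation G N T (t, x))"
    if "0 \<le> t" "x \<in> carrier (DD_hat G N T)" for t x
    using that by (rule descent_proj_hat)
  ultimately show ?thesis
    using cont
    by (intro conjI exI[of _ CC.descent])
      (simp_all add: CC.descent_hom CC.descent_norm CC.descent_one CC.descent_zero CC.descent_mult)
qed

end
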